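(* Let $m,n\geq 1$. The $m$-Tamari lattice $\mathcal{T}_n^{(m)}$, taken with its order reversed, is both (isomorphic to) a sublattice and (isomorphic to) a quotient lattice of the metasylvester lattice on $\mathcal{M}ax_n^{(m)}$.
   Context: An $m$-permutation of size $n$ is a rearrangement of the word $1^m2^m\cdots n^m$; their set is $\mathfrak{S}_n^{(m)}$. For a letter $b$, $b_i$ denotes the $i$-th occurrence of $b$ from the left. A co-inversion of $\sigma\in\mathfrak{S}_n^{(m)}$ is a pair $(a_i,b_j)$ with $1\leq a<b\leq n$, $1\le i,j\le m$, such that $b_j$ appears before $a_i$ in $\sigma$; $\mathrm{coinv}(\sigma)$ is the set of co-inversions, and $\sigma\leq\mu$ means $\mathrm{coinv}(\sigma)\subseteq\mathrm{coinv}(\mu)$ (the $m$-permutations lattice). The metasylvester congruence $\equiv$ on $\mathfrak{S}_n^{(m)}$ is the equivalence relation generated by $u\,ac\,v\,a\,w\equiv u\,ca\,v\,a\,w$ for letters $a<c$ and words $u,v,w$, and $u\,b\,v\,ac\,w\,b\,x\equiv u\,b\,v\,ca\,w\,b\,x$ for letters $a<b<c$ and words $u,v,w,x$. Each class contains a unique maximal element for $\leq$, which is the only element of the class containing no subword (not necessarily consecutive) $a\cdots b\cdots a$ with $a<b$; $\mathcal{M}ax_n^{(m)}$ is the set of all these maximal elements. The metasylvester lattice is $\mathcal{M}ax_n^{(m)}$ with the order induced from $\mathfrak{S}_n^{(m)}$; it is a lattice. The $m$-Tamari lattice $\mathcal{T}_n^{(m)}$ is defined on $m$-ballot paths of size $n$: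 lattice paths from $(0,0)$ to $(nm,n)$ made of horizontal steps $E=(1,0)$ and vertical steps $N=(0,1)$ that always stay (weakly) above the line $y=x/m$. The cover relation is rotation: if a path has an $E$ step immediately followed by an $N$ step, let $P$ be the shortest nonempty factor of the path starting with this $N$ step that is, up to translation, an $m$-ballot path (it has $k$ steps $N$ and $mk$ steps $E$ for some $k\ge1$); exchanging the $E$ step and the factor $P$ yields a path which covers the original one (is larger). The order is the reflexive-transitive closure of this relation. A sublattice is a subset closed under join and meet, with the induced order; a quotient lattice is the quotient by a lattice congruence (an equivalence relation compatible with both join and meet). *)

theory Defs
  imports "HOL-Algebra.Lattice" "HOL-Library.Multiset" "HOL-Library.Sublist"
begin

section \<open>The metasylvester lattice\<close>

definition m_perms :: "nat \<Rightarrow> nat \<Rightarrow> nat list set" where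
  "m_perms m n = {w. mset w = mset (concat (map (replicate m) [1..<n+1]))}"

text \<open>The letter at position \<open>p\<close> (counted from 0), together with the number
  \<open>i \<ge> 1\<close> such that it is the \<open>i\<close>-th occurrence of this letter from the left.\<close>

definition occurrence :: "nat list \<Rightarrow> nat \<Rightarrow> nat \<times> nat" where
  "occurrence w p = (w ! p, count_list (take (Suc p) w) (w ! p))"

text \<open>A co-inversion \<open>(a\<^sub>i, b\<^sub>j)\<close> is encoded as \<open>((a, i), (b, j))\<close>; the smaller letter comes
  first in the pair but later in the word.\<close>

definition coinv :: "nat list \<Rightarrow> ((nat \<times> nat) \<times> (nat \<times> nat)) set" where
  "coinv w = {(occurrence w q, occurrence w p) | p q. p < q \<and> q < length w \<and> w ! q < w ! p}"

inductive metasylv_step :: "nat list \<Rightarrow> nat list \<Rightarrow> bool" where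
  "a < c \<Longrightarrow> metasylv_step (u @ [a, c] @ v @ [a] @ w) (u @ [c, a] @ v @ [a] @ w)"
| "a < b \<Longrightarrow> b < c \<Longrightarrow>
    metasylv_step (u @ [b] @ v @ [a, c] @ w @ [b] @ x) (u @ [b] @ v @ [c, a] @ w @ [b] @ x)"

abbreviation metasylv :: "nat list \<Rightarrow> nat list \<Rightarrow> bool" where
  "metasylv \<equiv> equivclp metasylv_step"

definition metasylv_max :: "nat \<Rightarrow> nat \<Rightarrow> nat list set" where
  "metasylv_max m n = {w \<in> m_perms m n.
     \<forall>w' \<in> m_perms m n. metasylv w w' \<and> coinv w \<subseteq> coinv w' \<longrightarrow> w' = w}"

definition metasylvester :: "nat \<Rightarrow> nat \<Rightarrow> nat list gorder" where
  "metasylvester m n =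
     \<lparr>carrier = metasylv_max m n, eq = (=), le = (\<lambda>w w'. coinv w \<subseteq> coinv w')\<rparr>"


section \<open>The m-Tamari lattice\<close>

datatype step = North | East

text \<open>A lattice path starting at the origin is the list of its steps. After a prefix \<open>p\<close> it has
  reached the point \<open>(x, y)\<close> where \<open>x\<close> and \<open>y\<close> are the numbers of East and North steps of \<open>p\<close>,
  and lying weakly above the line \<open>y = x / m\<close> means \<open>x \<le> m * y\<close>.\<close>

definition ballot_path :: "nat \<Rightarrow> nat \<Rightarrow> step list \<Rightarrow> bool" where
  "ballot_path m n w \<longleftrightarrow>
     count_list w North = n \<and> count_list w East = n * m \<and>
     (\<forall>p. prefix p w \<longrightarrow> count_list p East \<le> m * count_list p North)"

text \<open>A nonempty ballot path necessarily starts with a North step, so the factor \<open>P\<close> below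
  starts with a North step immediately following the exchanged East step.\<close>

inductive rotation :: "nat \<Rightarrow> step list \<Rightarrow> step list \<Rightarrow> bool" for m where
  "P \<noteq> [] \<Longrightarrow> ballot_path m k P \<Longrightarrow>
   (\<And>Q j. strict_prefix Q P \<Longrightarrow> Q \<noteq> [] \<Longrightarrow> \<not> ballot_path m j Q) \<Longrightarrow>
   rotation m (u @ [East] @ P @ v) (u @ P @ [East] @ v)"

definition tamari :: "nat \<Rightarrow> nat \<Rightarrow> step list gorder" where
  "tamari m n = \<lparr>carrier = {w. ballot_path m n w}, eq = (=), le = (rotation m)\<^sup>*\<^sup>*\<rparr>"


section \<open>Sublattices, quotient lattices and isomorphisms\<close>

definition sublattice :: "'a set \<Rightarrow> 'a gorder \<Rightarrow> bool" where
  "sublattice S L \<longleftrightarrow> lattice L \<and> S \<subseteq> carrier L \<and>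
     (\<forall>x\<in>S. \<forall>y\<in>S. x \<squnion>\<^bsub>L\<^esub> y \<in> S \<and> x \<sqinter>\<^bsub>L\<^esub> y \<in> S)"

definition lattice_congruence :: "('a \<times> 'a) set \<Rightarrow> 'a gorder \<Rightarrow> bool" where
  "lattice_congruence \<theta> L \<longleftrightarrow> lattice L \<and> equiv (carrier L) \<theta> \<and>
     (\<forall>(x, x')\<in>\<theta>. \<forall>(y, y')\<in>\<theta>.
        (x \<squnion>\<^bsub>L\<^esub> y, x' \<squnion>\<^bsub>L\<^esub> y') \<in> \<theta> \<and> (x \<sqinter>\<^bsub>L\<^esub> y, x' \<sqinter>\<^bsub>L\<^esub> y') \<in> \<theta>)"

text \<open>The join of two classes is the class of the join of representatives; for a congruence the
  union below consists of equal sets. The order of the quotient is the one determined by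
  this join.\<close>

definition quotient_join :: "'a gorder \<Rightarrow> ('a \<times> 'a) set \<Rightarrow> 'a set \<Rightarrow> 'a set \<Rightarrow> 'a set" where
  "quotient_join L \<theta> X Y = (\<Union>x\<in>X. \<Union>y\<in>Y. \<theta> `` {x \<squnion>\<^bsub>L\<^esub> y})"

definition quotient_lattice :: "'a gorder \<Rightarrow> ('a \<times> 'a) set \<Rightarrow> 'a set gorder" where
  "quotient_lattice L \<theta> =
     \<lparr>carrier = carrier L // \<theta>, eq = (=), le = (\<lambda>X Y. quotient_join L \<theta> X Y = Y)\<rparr>"

text \<open>Both \<^const>\<open>join_pres\<close> and \<^const>\<open>meet_pres\<close> include that \<open>K\<close> and \<open>L\<close> are lattices.\<close>

definition lattice_isomorphic :: "'a gorder \<Rightarrow> 'b gorder \<Rightarrow> bool" where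
  "lattice_isomorphic K L \<longleftrightarrow>
     (\<exists>f. bij_betw f (carrier K) (carrier L) \<and> join_pres K L f \<and> meet_pres K L f)"

end

theory Submission
  imports Defs
begin

text \<open>A maximal word is determined by the numbers of letters \<open>c\<close> preceding the block of \<open>a\<close>'s, for
  \<open>a < c\<close>, and the order is the pointwise order of these numbers; we encode them as a set
  of triples. Labelling each East step of a ballot path by the North step it is matched with turns
  the path into such a table, and the tables obtained in this way are those in which every row
  contains all later ones. A rotation removes one East step from the rows of the exchanged factor,
  which gives the inclusion order reversed. The map sending a table to the
  least decreasing table above it is a closure operator with join-closed image that also has a
  left adjoint. It is therefore a lattice retraction: its image is a sublattice and its kernel a
  congruence, with the same quotient.\<close>

section \<open>Tables\<close>

text \<open>In a maximal word no larger letter separates two copies of \<open>a\<close>, so the last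
  copy can stand for all of them; this is what reduces co-inversions to triples with a single index.
  Union and intersection are not the lattice operations on tables: a union has to be closed under
  transitivity, and an intersection can lose cotransitivity, as {(1,3,1),(2,3,1)} and
  {(1,2,1),(1,3,1)} show for \<open>m = 1\<close>. Meets are only obtained as joins of lower bounds,
  which is why compatibility of the hull with meets is derived from an adjunction and not from a
  computation. On the Tamari side a decreasing table is determined by the sizes of its rows, which
  are the East counts of the path before its North steps; tables of rotated paths are therefore
  compared by counting alone. Rotations generate the whole inclusion order because every decreasing
  table strictly below another one lies below some table obtained from it by dropping a single
  peak.\<close>

definition triples :: "nat \<Rightarrow> nat \<Rightarrow> (nat \<times> nat \<times> nat) set" where
  "triples m n = {(a, c, j). 1 \<le> a \<and> a < c \<and> c \<le> n \<and> 1 \<le> j \<and> j \<le> m}"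

text \<open>An entry \<open>(a, c, j)\<close> says that the \<open>j\<close>-th \<open>c\<close> precedes the block of all \<open>a\<close>'s. Transitivity of
  ``precedes'' and of its negation give the last two conditions, which turn out to be
  sufficient for the table to come from a word.\<close>

definition tables :: "nat \<Rightarrow> nat \<Rightarrow> (nat \<times> nat \<times> nat) set set" where
  "tables m n = {X. X \<subseteq> triples m n \<and>
     (\<forall>a c j k. (a, c, j) \<in> X \<longrightarrow> 1 \<le> k \<longrightarrow> k \<le> j \<longrightarrow> (a, c, k) \<in> X) \<and>
     (\<forall>a b c i j. (a, b, i) \<in> X \<longrightarrow> (b, c, j) \<in> X \<longrightarrow> (a, c, j) \<in> X) \<and>
     (\<forall>a b c j. (a, c, j) \<in> X \<longrightarrow> a < b \<longrightarrow> b < c \<longrightarrow> (b, c, j) \<in> X \<or> (a, b, m) \<in> X)}"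

definition dec_tables :: "nat \<Rightarrow> nat \<Rightarrow> (nat \<times> nat \<times> nat) set set" where
  "dec_tables m n =
     {X \<in> tables m n. \<forall>a b c j. (b, c, j) \<in> X \<longrightarrow> 1 \<le> a \<longrightarrow> a < b \<longrightarrow> (a, c, j) \<in> X}"

lemma triplesD: "(a, c, j) \<in> triples m n \<Longrightarrow> 1 \<le> a \<and> a < c \<and> c \<le> n \<and> 1 \<le> j \<and> j \<le> m"
  by (simp add: triples_def)

lemma finite_triples: "finite (triples m n)"
  by (rule finite_subset[of _ "{1..n} \<times> {1..n} \<times> {1..m}"]) (auto simp: triples_def)

context
  fixes m n X
  assumes X: "X \<in> tables m n"
begin

lemma tables_triples: "X \<subseteq> triples m n"
  using X by (simp add: tables_def)

lemma tables_range: "(a, c, j) \<in> X \<Longrightarrow> 1 \<le> a \<and> a < c \<and> c \<le> n \<and> 1 \<le> j \<and> j \<le> m"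
  using tables_triples triplesD by blast

lemma tables_down: "(a, c, j) \<in> X \<Longrightarrow> 1 \<le> k \<Longrightarrow> k \<le> j \<Longrightarrow> (a, c, k) \<in> X"
  using X unfolding tables_def by blast

lemma tables_trans: "(a, b, i) \<in> X \<Longrightarrow> (b, c, j) \<in> X \<Longrightarrow> (a, c, j) \<in> X"
  using X unfolding tables_def by blast

lemma tables_cotrans:
  "(a, c, j) \<in> X \<Longrightarrow> a < b \<Longrightarrow> b < c \<Longrightarrow> (b, c, j) \<in> X \<or> (a, b, m) \<in> X"
  using X unfolding tables_def by blast

lemma finite_tables: "finite X"
  using tables_triples finite_triples finite_subset by blast

end

lemma tablesI:
  assumes "X \<subseteq> triples m n"
    and "\<And>a c j k. (a, c, j) \<in> X \<Longrightarrow> 1 \<le> k \<Longrightarrow> k \<le> j \<Longrightarrow> (a, c, k) \<in> X"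
    and "\<And>a b c i j. (a, b, i) \<in> X \<Longrightarrow> (b, c, j) \<in> X \<Longrightarrow> (a, c, j) \<in> X"
    and "\<And>a b c j. (a, c, j) \<in> X \<Longrightarrow> a < b \<Longrightarrow> b < c \<Longrightarrow> (b, c, j) \<in> X \<or> (a, b, m) \<in> X"
  shows "X \<in> tables m n"
  using assms unfolding tables_def by blast

lemma dec_tablesD: "X \<in> dec_tables m n \<Longrightarrow> X \<in> tables m n"
  by (simp add: dec_tables_def)

lemma dec_tables_dec:
  "X \<in> dec_tables m n \<Longrightarrow> (b, c, j) \<in> X \<Longrightarrow> 1 \<le> a \<Longrightarrow> a \<le> b \<Longrightarrow> (a, c, j) \<in> X"
  by (cases "a = b") (auto simp: dec_tables_def)

section \<open>Transitive closures and joins of tables\<close>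

inductive_set tclosure :: "(nat \<times> nat \<times> nat) set \<Rightarrow> (nat \<times> nat \<times> nat) set" for B where
  base: "t \<in> B \<Longrightarrow> t \<in> tclosure B"
| trans: "(a, b, i) \<in> tclosure B \<Longrightarrow> (b, c, j) \<in> tclosure B \<Longrightarrow> (a, c, j) \<in> tclosure B"

lemma tclosure_least:
  assumes "X \<in> tables m n" "B \<subseteq> X"
  shows "tclosure B \<subseteq> X"
proof
  fix t assume "t \<in> tclosure B"
  then show "t \<in> X"
    by induction (use assms tables_trans in blast)+
qed

lemma tclosure_triples:
  assumes "B \<subseteq> triples m n"
  shows "tclosure B \<subseteq> triples m n"
proof
  fix t assume "t \<in> tclosure B"
  then show "t \<in> triples m n"
    by induction (use assms in \<open>auto simp: triples_def\<close>)
qed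

text \<open>Only transitivity has to be forced. For cotransitivity at \<open>b\<close> of a
  composite through \<open>d\<close>, the position of \<open>b\<close> relative to \<open>d\<close>
  selects the factor to split; where necessary, the piece obtained is composed with the other
  factor.\<close>

lemma tclosure_in_tables:
  assumes sub: "B \<subseteq> triples m n"
    and down: "\<And>a c j k. (a, c, j) \<in> B \<Longrightarrow> 1 \<le> k \<Longrightarrow> k \<le> j \<Longrightarrow> (a, c, k) \<in> tclosure B"
    and cotrans: "\<And>a b c j. (a, c, j) \<in> B \<Longrightarrow> a < b \<Longrightarrow> b < c \<Longrightarrow>
        (b, c, j) \<in> tclosure B \<or> (a, b, m) \<in> tclosure B"
  shows "tclosure B \<in> tables m n"
proof (rule tablesI)
  show "tclosure B \<subseteq> triples m n"
    using sub by (rule tclosure_triples)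
next
  have "\<forall>a c j k. t = (a, c, j) \<longrightarrow> 1 \<le> k \<longrightarrow> k \<le> j \<longrightarrow> (a, c, k) \<in> tclosure B"
    if "t \<in> tclosure B" for t
    using that
  proof induction
    case (trans a b i c j)
    then show ?case by (metis prod.inject tclosure.trans)
  qed (use down in blast)
  then show "(a, c, k) \<in> tclosure B" if "(a, c, j) \<in> tclosure B" "1 \<le> k" "k \<le> j" for a c j k
    using that by blast
next
  have "\<forall>a b c j. t = (a, c, j) \<longrightarrow> a < b \<longrightarrow> b < c \<longrightarrow>
      (b, c, j) \<in> tclosure B \<or> (a, b, m) \<in> tclosure B" if "t \<in> tclosure B" for t
    using that
  proof induction
    case (trans a d i c j)
    show ?case
    proof (intro allI impI)
      fix a' b c' j'
      assume *: "(a, c, j) = (a', c', j')" "a' < b" "b < c'"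
      consider "b < d" | "b = d" | "d < b" by linarith
      then show "(b, c', j') \<in> tclosure B \<or> (a', b, m) \<in> tclosure B"
        by cases (use * trans tclosure.trans in blast)+
    qed
  qed (use cotrans in blast)
  then show "(b, c, j) \<in> tclosure B \<or> (a, b, m) \<in> tclosure B"
    if "(a, c, j) \<in> tclosure B" "a < b" "b < c" for a b c j
    using that by blast
qed (rule tclosure.trans)

text \<open>This is the join of the family. Arbitrary families are allowed because meets will be
  formed as joins of all lower bounds.\<close>

lemma tclosure_Union_in_tables:
  assumes "F \<subseteq> tables m n"
  shows "tclosure (\<Union>F) \<in> tables m n"
proof (rule tclosure_in_tables)
  show "\<Union>F \<subseteq> triples m n"
    using assms tables_triples by blast
  show "(a, c, k) \<in> tclosure (\<Union>F)" if "(a, c, j) \<in> \<Union>F" "1 \<le> k" "k \<le> j" for a c j k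
  proof -
    from that obtain X where X: "X \<in> F" "(a, c, j) \<in> X" by blast
    then have "(a, c, k) \<in> X"
      using tables_down that assms by blast
    then show ?thesis
      using X tclosure.base by blast
  qed
  show "(b, c, j) \<in> tclosure (\<Union>F) \<or> (a, b, m) \<in> tclosure (\<Union>F)"
    if "(a, c, j) \<in> \<Union>F" "a < b" "b < c" for a b c j
  proof -
    from that obtain X where X: "X \<in> F" "(a, c, j) \<in> X" by blast
    then have "(b, c, j) \<in> X \<or> (a, b, m) \<in> X"
      using tables_cotrans that assms by blast
    then show ?thesis
      using X tclosure.base by blast
  qed
qed

text \<open>Lowering the first coordinate of a composite only affects its left factor, so
  decreasingness passes from generators to composites.\<close>

lemma tclosure_Un_in_dec_tables:
  assumes "X \<in> dec_tables m n" "Y \<in> dec_tables m n"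
  shows "tclosure (X \<union> Y) \<in> dec_tables m n"
proof -
  have "tclosure (X \<union> Y) \<in> tables m n"
    using tclosure_Union_in_tables[of "{X, Y}"] assms dec_tablesD by auto
  moreover have "\<forall>a b c j. t = (b, c, j) \<longrightarrow> 1 \<le> a \<longrightarrow> a < b \<longrightarrow> (a, c, j) \<in> tclosure (X \<union> Y)"
    if "t \<in> tclosure (X \<union> Y)" for t
    using that
  proof induction
    case (base t)
    then show ?case
      using assms dec_tables_dec by (metis UnCI UnE less_imp_le tclosure.base)
  next
    case (trans a b i c j)
    then show ?case by (metis prod.inject tclosure.trans)
  qed
  ultimately show ?thesis by (simp add: dec_tables_def)
qed

section \<open>The decreasing hull and its left adjoint\<close>

definition dec_hull :: "(nat \<times> nat \<times> nat) set \<Rightarrow> (nat \<times> nat \<times> nat) set" where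
  "dec_hull X = {(a, c, j). 1 \<le> a \<and> (\<exists>b\<ge>a. (b, c, j) \<in> X)}"

lemma dec_hull_mono: "X \<subseteq> Y \<Longrightarrow> dec_hull X \<subseteq> dec_hull Y"
  by (auto simp: dec_hull_def)

lemma dec_hull_extensive: "X \<in> tables m n \<Longrightarrow> X \<subseteq> dec_hull X"
  using tables_range by (fastforce simp: dec_hull_def)

lemma dec_hull_dec:
  assumes "X \<in> dec_tables m n"
  shows "dec_hull X = X"
proof
  show "dec_hull X \<subseteq> X"
    unfolding dec_hull_def using dec_tables_dec[OF assms] by blast
qed (rule dec_hull_extensive[OF dec_tablesD[OF assms]])

lemma dec_hull_in_dec_tables:
  assumes X: "X \<in> tables m n"
  shows "dec_hull X \<in> dec_tables m n"
proof -
  have "dec_hull X \<in> tables m n"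
  proof (rule tablesI)
    show "dec_hull X \<subseteq> triples m n"
      using tables_range[OF X] by (fastforce simp: dec_hull_def triples_def)
    show "(a, c, k) \<in> dec_hull X" if "(a, c, j) \<in> dec_hull X" "1 \<le> k" "k \<le> j" for a c j k
      using that tables_down[OF X] by (auto simp: dec_hull_def)
    show "(a, c, j) \<in> dec_hull X" if "(a, b, i) \<in> dec_hull X" "(b, c, j) \<in> dec_hull X" for a b c i j
      using that tables_range[OF X] by (auto simp: dec_hull_def) (meson le_trans less_imp_le)
    show "(b, c, j) \<in> dec_hull X \<or> (a, b, m) \<in> dec_hull X"
      if h: "(a, c, j) \<in> dec_hull X" "a < b" "b < c" for a b c j
    proof -
      from h obtain d where d: "1 \<le> a" "a \<le> d" "(d, c, j) \<in> X"
        by (auto simp: dec_hull_def)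
      \<comment> \<open>If \<open>b\<close> is at most \<open>d\<close>, then \<open>d\<close> also
        witnesses \<open>(b, c, j)\<close>. Otherwise the entry of \<open>X\<close> in row
        \<open>d\<close> is split at \<open>b\<close>, and \<open>(d, b, m)\<close> is inherited by
        row \<open>a\<close> of the hull.\<close>
      show ?thesis
      proof (cases "b \<le> d")
        case True
        then show ?thesis using d h by (auto simp: dec_hull_def)
      next
        case False
        then have "(b, c, j) \<in> X \<or> (d, b, m) \<in> X"
          using tables_cotrans[OF X d(3)] h by simp
        then show ?thesis using d h by (auto simp: dec_hull_def)
      qed
    qed
  qed
  moreover have "(a, c, j) \<in> dec_hull X" if "(b, c, j) \<in> dec_hull X" "1 \<le> a" "a < b" for a b c j
    using that by (auto simp: dec_hull_def) (meson le_trans less_imp_le)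
  ultimately show ?thesis
    unfolding dec_tables_def by blast
qed

text \<open>The transitive closure of the last entries of \<open>Z\<close> is the least table whose hull contains
  \<open>Z\<close>. Hence \<open>dec_hull\<close> has a left adjoint, which makes it compatible with meets; compatibility
  with joins only needs that it is a closure operator with join-closed image.\<close>

definition last_entries :: "(nat \<times> nat \<times> nat) set \<Rightarrow> (nat \<times> nat \<times> nat) set" where
  "last_entries Z = {(a, c, j) \<in> Z. \<forall>b>a. (b, c, j) \<notin> Z}"

lemma last_entry_above:
  assumes "Z \<in> tables m n" "(a, c, j) \<in> Z"
  obtains b where "a \<le> b" "b < c" "(b, c, j) \<in> last_entries Z"
proof -
  let ?B = "{b. (b, c, j) \<in> Z}"
  have "finite ?B"
    by (rule finite_subset[of _ "{..c}"]) (use tables_range[OF assms(1)] in fastforce)+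
  then have "Max ?B \<in> ?B" "\<forall>b\<in>?B. b \<le> Max ?B"
    using assms(2) Max_in[of ?B] Max_ge[of ?B] by blast+
  then show ?thesis
    using assms tables_range[OF assms(1), of "Max ?B"] that[of "Max ?B"]
    by (fastforce simp: last_entries_def)
qed

text \<open>Since \<open>(a, c, j)\<close> is a last entry, no \<open>(d, c, j)\<close> with
  \<open>a < d\<close> lies in \<open>Z\<close>, and cotransitivity puts \<open>(a, d, m)\<close>
  into \<open>Z\<close> for every \<open>d\<close> between \<open>a\<close> and \<open>c\<close>.
  The last entry belonging to \<open>(a, b, i)\<close> starts at \<open>a\<close> or at such a
  \<open>d\<close>, which the induction reaches from \<open>a\<close>.\<close>

lemma tclosure_last_entries_full:
  assumes Z: "Z \<in> tables m n" and full: "(a, b, m) \<in> Z"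
    and ac: "(a, c, j) \<in> last_entries Z" and "1 \<le> i" "i \<le> m" "a < b" "b < c"
  shows "(a, b, i) \<in> tclosure (last_entries Z)"
  using full \<open>a < b\<close> \<open>b < c\<close>
proof (induction b rule: less_induct)
  case (less b)
  have "(a, b, i) \<in> Z"
    using tables_down[OF Z] less assms by blast
  then obtain d where d: "a \<le> d" "d < b" "(d, b, i) \<in> last_entries Z"
    by (rule last_entry_above[OF Z])
  show ?case
  proof (cases "a = d")
    case False
    then have "(d, c, j) \<notin> Z" "(a, c, j) \<in> Z"
      using ac d by (auto simp: last_entries_def)
    then have "(a, d, m) \<in> Z"
      using tables_cotrans[OF Z, of a c j d] False d less by auto
    then have "(a, d, i) \<in> tclosure (last_entries Z)"
      using less d False by auto
    then show ?thesis
      using d tclosure.intros by blast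
  qed (use d tclosure.base in auto)
qed

lemma last_entries_full:
  assumes Z: "Z \<in> tables m n" and ac: "(a, c, j) \<in> last_entries Z"
    and "1 \<le> i" "i \<le> m" "a < b" "b < c"
  shows "(a, b, i) \<in> tclosure (last_entries Z)"
proof -
  have "(a, b, m) \<in> Z"
    using tables_cotrans[OF Z, of a c j b] assms by (auto simp: last_entries_def)
  then show ?thesis
    using tclosure_last_entries_full assms by blast
qed

text \<open>A last entry \<open>(a, c, j)\<close> makes all columns strictly between
  \<open>a\<close> and \<open>c\<close> full in row \<open>a\<close> of the closure. The second
  alternative of cotransitivity thus always holds, and a lower rank \<open>k\<close> is reached
  through the row \<open>d\<close> of its own last entry.\<close>

lemma tclosure_last_entries_in_tables:
  assumes Z: "Z \<in> tables m n"
  shows "tclosure (last_entries Z) \<in> tables m n"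
proof (rule tclosure_in_tables)
  show "last_entries Z \<subseteq> triples m n"
    using tables_triples[OF Z] by (auto simp: last_entries_def)
  fix a c j assume ac: "(a, c, j) \<in> last_entries Z"
  then have acZ: "(a, c, j) \<in> Z" by (auto simp: last_entries_def)
  note m = tables_range[OF Z acZ]
  show "(a, c, k) \<in> tclosure (last_entries Z)" if k: "1 \<le> k" "k \<le> j" for k
  proof -
    obtain d where d: "a \<le> d" "d < c" "(d, c, k) \<in> last_entries Z"
      using last_entry_above[OF Z] tables_down[OF Z acZ k] by blast
    show ?thesis
    proof (cases "a = d")
      case False
      then have "(a, d, 1) \<in> tclosure (last_entries Z)"
        using last_entries_full[OF Z ac, of 1 d] d m by auto
      then show ?thesis
        using d tclosure.intros by blast
    qed (use d tclosure.base in auto)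
  qed
  show "(b, c, j) \<in> tclosure (last_entries Z) \<or> (a, b, m) \<in> tclosure (last_entries Z)"
    if "a < b" "b < c" for b
    using last_entries_full[OF Z ac, of m b] m that by auto
qed

lemma subset_dec_hull_tclosure_last_entries:
  assumes Z: "Z \<in> tables m n"
  shows "Z \<subseteq> dec_hull (tclosure (last_entries Z))"
proof clarify
  fix a c j assume ac: "(a, c, j) \<in> Z"
  then obtain d where "a \<le> d" "(d, c, j) \<in> last_entries Z"
    using last_entry_above[OF Z] by blast
  then show "(a, c, j) \<in> dec_hull (tclosure (last_entries Z))"
    using tclosure.base tables_range[OF Z ac] by (auto simp: dec_hull_def)
qed

text \<open>Every generator increases from its first to its second coordinate, so a composite is
  wider than both factors and its derivation uses no generator wider than itself. This bound
  supports the induction on width in the adjunction.\<close>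

lemma tclosure_narrow:
  assumes t: "t \<in> tclosure B" and B: "\<And>a c j. (a, c, j) \<in> B \<Longrightarrow> a < c"
  shows "t \<in> tclosure {(a, c, j) \<in> B. c - a \<le> fst (snd t) - fst t} \<and> fst t < fst (snd t)"
  using t
proof induction
  case (base t)
  then show ?case
    using B by (cases t) (auto intro!: tclosure.base)
next
  case (trans a b i c j)
  have mono: "tclosure B1 \<subseteq> tclosure B2" if "B1 \<subseteq> B2" for B1 B2
  proof
    fix t assume "t \<in> tclosure B1"
    then show "t \<in> tclosure B2"
      by induction (use that tclosure.intros in blast)+
  qed
  have "tclosure {(a', c', j) \<in> B. c' - a' \<le> b - a} \<subseteq> tclosure {(a', c', j) \<in> B. c' - a' \<le> c - a}"
       "tclosure {(a', c', j) \<in> B. c' - a' \<le> c - b} \<subseteq> tclosure {(a', c', j) \<in> B. c' - a' \<le> c - a}"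
    using trans by (auto intro!: mono)
  moreover have "(a, b, i) \<in> tclosure {(a', c', j) \<in> B. c' - a' \<le> b - a}"
    "(b, c, j) \<in> tclosure {(a', c', j) \<in> B. c' - a' \<le> c - b}" "a < b" "b < c"
    using trans.IH by simp_all
  ultimately show ?case
    using tclosure.trans[of a b i _ c j] by (auto simp: subset_iff)
qed

text \<open>A generator \<open>(a, c, j)\<close> comes with some \<open>(d, c, j)\<close> in
  \<open>X\<close> where \<open>a \<le> d\<close>. If \<open>d\<close> is not \<open>a\<close>, the
  gap from \<open>a\<close> to \<open>d\<close> is bridged by strictly narrower generators, already
  in \<open>X\<close>, and transitivity of \<open>X\<close> finishes.\<close>

lemma tclosure_last_entries_adjoint:
  assumes Z: "Z \<in> tables m n" and X: "X \<in> tables m n" and sub: "Z \<subseteq> dec_hull X"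
  shows "tclosure (last_entries Z) \<subseteq> X"
proof (rule tclosure_least[OF X])
  have "(a, c, j) \<in> X" if "(a, c, j) \<in> last_entries Z" for a c j
    using that
  proof (induction "c - a" arbitrary: a c j rule: less_induct)
    case less
    then have "(a, c, j) \<in> dec_hull X"
      using sub by (auto simp: last_entries_def)
    then obtain d where d: "a \<le> d" "(d, c, j) \<in> X"
      by (auto simp: dec_hull_def)
    have r: "1 \<le> d \<and> d < c \<and> c \<le> n \<and> 1 \<le> j \<and> j \<le> m"
      using tables_range[OF X d(2)] .
    show ?case
    proof (cases "a = d")
      case False
      let ?B = "{(a', c', j) \<in> last_entries Z. c' - a' \<le> d - a}"
      \<comment> \<open>Rank 1 is as good as any other: transitivity accepts every copy of the
        middle letter.\<close>
      have "(a, d, 1) \<in> tclosure (last_entries Z)"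
        using last_entries_full[OF Z less.prems, of 1 d] d r False by auto
      moreover have "a < c" if "(a, c, j) \<in> last_entries Z" for a c j
        using that tables_range[OF Z] by (auto simp: last_entries_def)
      ultimately have "(a, d, 1) \<in> tclosure ?B"
        using tclosure_narrow[of "(a, d, 1)" "last_entries Z"] by simp
      moreover have "?B \<subseteq> X"
        using less.hyps r d False by auto
      ultimately have "(a, d, 1) \<in> X"
        using tclosure_least[OF X] by blast
      then show ?thesis
        using d tables_trans[OF X] by blast
    qed (use d in auto)
  qed
  then show "last_entries Z \<subseteq> X" by auto
qed

definition table_lattice :: "nat \<Rightarrow> nat \<Rightarrow> (nat \<times> nat \<times> nat) set gorder" where
  "table_lattice m n = \<lparr>carrier = tables m n, eq = (=), le = (\<subseteq>)\<rparr>"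

lemma lattice_table_lattice: "lattice (table_lattice m n)"
proof -
  let ?L = "table_lattice m n"
  interpret partial_order ?L
    by unfold_locales (auto simp: table_lattice_def)
  have sup: "\<exists>s. least ?L s (Upper ?L F)" if "F \<subseteq> tables m n" for F
  proof
    have "tclosure (\<Union>F) \<subseteq> X" if "X \<in> tables m n" "\<forall>Y\<in>F. Y \<subseteq> X" for X
      using that by (intro tclosure_least) auto
    moreover have "Y \<subseteq> tclosure (\<Union>F)" if "Y \<in> F" for Y
      using that tclosure.base by blast
    ultimately show "least ?L (tclosure (\<Union>F)) (Upper ?L F)"
      using tclosure_Union_in_tables[OF that] that
      unfolding least_def Upper_def table_lattice_def gorder.simps partial_object.simps by blast
  qed
  show ?thesis
  proof unfold_locales
    fix x y assume xy: "x \<in> carrier ?L" "y \<in> carrier ?L"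
    then show "\<exists>s. least ?L s (Upper ?L {x, y})"
      by (intro sup) (auto simp: table_lattice_def)
    \<comment> \<open>The meet is the join of all common lower bounds, which exists since
      \<open>sup\<close> covers arbitrary families.\<close>
    obtain s where s: "least ?L s (Upper ?L (Lower ?L {x, y}))"
      using sup[of "Lower ?L {x, y}"] Lower_closed[of ?L] by (auto simp: table_lattice_def)
    have "greatest ?L s (Lower ?L {x, y})"
      unfolding greatest_def
    proof (intro conjI ballI)
      show "Lower ?L {x, y} \<subseteq> carrier ?L" by simp
      show "s \<in> Lower ?L {x, y}"
        using s xy unfolding least_def Upper_def Lower_def by auto
      show "z \<sqsubseteq>\<^bsub>?L\<^esub> s" if "z \<in> Lower ?L {x, y}" for z
        using Upper_memD[OF least_mem[OF s] that] by simp
    qed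
    then show "\<exists>s. greatest ?L s (Lower ?L {x, y})" by blast
  qed
qed

section \<open>Maximal words and tables\<close>

lemma count_list_concat_replicate:
  "count_list (concat (map (replicate m) [1..<n+1])) a = (if 1 \<le> a \<and> a \<le> n then m else 0)"
proof (induction n)
  case (Suc n)
  have "count_list (replicate m b) a = (if a = b then m else 0)" for b
    by (induction m) auto
  with Suc show ?case by auto
qed simp

lemma m_perms_iff: "w \<in> m_perms m n \<longleftrightarrow> (\<forall>a. count_list w a = (if 1 \<le> a \<and> a \<le> n then m else 0))"
  unfolding m_perms_def mem_Collect_eq multiset_eq_iff count_mset count_list_concat_replicate ..

section \<open>The order of the occurrences in a word\<close>

lemma fst_occurrence [simp]: "fst (occurrence w p) = w ! p"
  by (simp add: occurrence_def)

lemma occurrence_append_left: "p < length u \<Longrightarrow> occurrence (u @ v) p = occurrence u p"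
  by (simp add: occurrence_def nth_append)

lemma occurrence_append_length: "occurrence (u @ x # v) (length u) = (x, Suc (count_list u x))"
  by (simp add: occurrence_def)

lemma occurrence_snd_mono:
  assumes "p < q" "q < length w" "w ! p = w ! q"
  shows "snd (occurrence w p) < snd (occurrence w q)"
proof -
  have "take (Suc p) (take q w) = take (Suc p) w"
    using assms(1) by (simp add: min_def)
  then have "take q w = take (Suc p) w @ drop (Suc p) (take q w)"
    using append_take_drop_id[of "Suc p" "take q w"] by simp
  then have "count_list (take q w) (w ! q) \<ge> count_list (take (Suc p) w) (w ! q)"
    by (metis count_list_append le_add1)
  then have "count_list (take (Suc q) w) (w ! q) > count_list (take (Suc p) w) (w ! q)"
    using assms(2) by (simp add: take_Suc_conv_app_nth)
  then show ?thesis
    using assms by (simp add: occurrence_def)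
qed

lemma inj_on_occurrence: "inj_on (occurrence w) {..<length w}"
proof (rule inj_onI)
  fix p q assume pq: "p \<in> {..<length w}" "q \<in> {..<length w}" "occurrence w p = occurrence w q"
  then have "w ! p = w ! q"
    by (metis fst_occurrence)
  then show "p = q"
    using pq occurrence_snd_mono[of p q w] occurrence_snd_mono[of q p w]
    by (metis lessThan_iff less_irrefl linorder_neqE_nat)
qed

lemma occurrence_image:
  "occurrence w ` {..<length w} = {(a, j). 1 \<le> j \<and> j \<le> count_list w a}"
proof (induction w rule: rev_induct)
  case (snoc x w)
  have "occurrence (w @ [x]) ` {..<length (w @ [x])} =
      insert (occurrence (w @ [x]) (length w)) (occurrence (w @ [x]) ` {..<length w})"
    by (simp add: lessThan_Suc)
  also have "occurrence (w @ [x]) ` {..<length w} = occurrence w ` {..<length w}"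
    by (intro image_cong) (auto simp: occurrence_append_left)
  finally show ?case
    using snoc by (auto simp: occurrence_append_length[of w x "[]"] le_Suc_eq split: if_splits)
qed simp

text \<open>Working with this strict total order on occurrences avoids positions in most later
  arguments. The earlier occurrence comes first, opposite to the pairs of
  \<open>coinv\<close>.\<close>

definition precedes :: "nat list \<Rightarrow> nat \<times> nat \<Rightarrow> nat \<times> nat \<Rightarrow> bool" where
  "precedes w y x \<longleftrightarrow> (\<exists>p q. p < q \<and> q < length w \<and> y = occurrence w p \<and> x = occurrence w q)"

lemma coinv_iff: "(x, y) \<in> coinv w \<longleftrightarrow> precedes w y x \<and> fst x < fst y"
  unfolding coinv_def precedes_def by (auto simp del: fst_conv) (metis fst_occurrence)+

lemma precedes_in:
  assumes "precedes w y x"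
  shows "1 \<le> snd y \<and> snd y \<le> count_list w (fst y)" "1 \<le> snd x \<and> snd x \<le> count_list w (fst x)"
proof -
  from assms obtain p q where "p < q" "q < length w" "y = occurrence w p" "x = occurrence w q"
    by (auto simp: precedes_def)
  then have "x \<in> occurrence w ` {..<length w}" "y \<in> occurrence w ` {..<length w}" by auto
  then show "1 \<le> snd y \<and> snd y \<le> count_list w (fst y)" "1 \<le> snd x \<and> snd x \<le> count_list w (fst x)"
    unfolding occurrence_image by auto
qed

lemma precedes_trans: "precedes w z y \<Longrightarrow> precedes w y x \<Longrightarrow> precedes w z x"
  unfolding precedes_def using inj_on_occurrence[of w, THEN inj_onD]
  by (metis lessThan_iff less_trans)

lemma precedes_asym: "precedes w y x \<Longrightarrow> \<not> precedes w x y"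
  unfolding precedes_def using inj_on_occurrence[of w, THEN inj_onD]
  by (metis lessThan_iff less_asym less_trans)

lemma precedes_irrefl: "\<not> precedes w x x"
  using precedes_asym by blast

lemma precedes_total:
  assumes "1 \<le> i" "i \<le> count_list w a" "1 \<le> j" "j \<le> count_list w b" "(a, i) \<noteq> (b, j)"
  shows "precedes w (a, i) (b, j) \<or> precedes w (b, j) (a, i)"
proof -
  have "(a, i) \<in> occurrence w ` {..<length w}" "(b, j) \<in> occurrence w ` {..<length w}"
    unfolding occurrence_image using assms by auto
  then obtain p q where "p < length w" "q < length w" "(a, i) = occurrence w p" "(b, j) = occurrence w q"
    by blast
  then show ?thesis
    unfolding precedes_def using assms(5) by (metis linorder_neqE_nat)
qed

lemma precedes_same_letter:
  assumes "1 \<le> i" "i < j" "j \<le> count_list w a"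
  shows "precedes w (a, i) (a, j)"
proof (rule ccontr)
  assume "\<not> ?thesis"
  then have "precedes w (a, j) (a, i)"
    using precedes_total[of i w a j a] assms by auto
  then obtain p q where "p < q" "q < length w" "(a, j) = occurrence w p" "(a, i) = occurrence w q"
    by (auto simp: precedes_def)
  then show False
    using occurrence_snd_mono[of p q w] assms by (metis fst_conv fst_occurrence order.asym snd_conv)
qed

lemma sorted_wrt_unique:
  assumes "sorted_wrt r xs" "sorted_wrt r ys" "set xs = set ys" "\<And>x y. r x y \<Longrightarrow> \<not> r y x"
  shows "xs = ys"
  using assms(1-3)
proof (induction xs arbitrary: ys)
  case (Cons x xs)
  then obtain y ys' where ys: "ys = y # ys'" by (cases ys) auto
  with Cons.prems have "x = y"
    using assms(4) by (metis list.set_intros(1) set_ConsD sorted_wrt.simps(2))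
  moreover have "x \<notin> set xs" "y \<notin> set ys'"
    using Cons.prems ys assms(4) by (metis sorted_wrt.simps(2))+
  ultimately show ?case
    using Cons ys by (metis insert_ident list.simps(15) sorted_wrt.simps(2))
qed simp

text \<open>Transitivity is demanded only on \<open>A\<close> because the relation read off a table
  is shown transitive only on the occurrences of letters in range.\<close>

lemma sorted_wrt_exists:
  assumes "finite A" "\<And>x y z. x \<in> A \<Longrightarrow> y \<in> A \<Longrightarrow> z \<in> A \<Longrightarrow> r x y \<Longrightarrow> r y z \<Longrightarrow> r x z"
    "\<And>x y. x \<in> A \<Longrightarrow> y \<in> A \<Longrightarrow> x \<noteq> y \<Longrightarrow> r x y \<or> r y x"
  shows "\<exists>xs. distinct xs \<and> set xs = A \<and> sorted_wrt r xs"
  using assms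
proof (induction A rule: finite_induct)
  case (insert x A)
  have "\<exists>xs. distinct xs \<and> set xs = A \<and> sorted_wrt r xs"
    by (rule insert.IH) (use insert.prems in blast)+
  then obtain xs where xs: "distinct xs" "set xs = A" "sorted_wrt r xs"
    by blast
  let ?ys = "filter (\<lambda>y. r y x) xs @ x # filter (\<lambda>y. \<not> r y x) xs"
  have above: "r x z" if "z \<in> A" "\<not> r z x" for z
    using that insert.prems(2)[of x z] insert.hyps(2) by auto
  have "r y z" if "y \<in> A" "z \<in> A" "r y x" "\<not> r z x" for y z
    using insert.prems(1)[of y x z] that above by blast
  then have "sorted_wrt r ?ys"
    unfolding sorted_wrt_append sorted_wrt.simps
    using xs above by (simp add: sorted_wrt_filter)
  moreover have "distinct ?ys" "set ?ys = insert x A"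
    using xs insert.hyps(2) by auto
  ultimately show ?case by blast
qed simp

lemma sorted_wrt_precedes: "sorted_wrt (precedes w) (map (occurrence w) [0..<length w])"
  by (auto simp: sorted_wrt_iff_nth_less precedes_def)

text \<open>Co-inversions fix the relative order of distinct letters, and copies of one letter are
  ordered by index, so the whole order of occurrences is determined; a word is the sorted list of
  its occurrences.\<close>

lemma inj_on_coinv: "inj_on coinv (m_perms m n)"
proof (rule inj_onI)
  fix w w' assume w: "w \<in> m_perms m n" "w' \<in> m_perms m n" and eq: "coinv w = coinv w'"
  have cnt: "count_list w = count_list w'"
    using w by (auto simp: m_perms_iff)
  have sub: "precedes v' y x" if "coinv v = coinv v'" "count_list v = count_list v'" "precedes v y x" for v v' y x
  proof (rule ccontr)
    assume n: "\<not> precedes v' y x"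
    obtain a i b j where xy: "x = (a, i)" "y = (b, j)" by fastforce
    have "x \<noteq> y" using that(3) precedes_irrefl[of v y] by blast
    then have *: "precedes v' x y"
      using precedes_total[of i v' a j b] n precedes_in[OF that(3)] that(2) xy by auto
    consider "a < b" | "a = b" | "b < a" by linarith
    then show False
    proof cases
      case 1
      then show ?thesis using that n xy coinv_iff[of x y v] coinv_iff[of x y v'] by simp
    next
      case 2
      then show ?thesis
        using precedes_same_letter[of i j v a] precedes_same_letter[of j i v' a] xy \<open>x \<noteq> y\<close>
          that n precedes_in[OF that(3)] precedes_asym[of v y x]
        by (cases "i < j") auto
    next
      case 3
      then show ?thesis
        using that * xy coinv_iff[of y x v] coinv_iff[of y x v'] precedes_asym[of v y x] by simp
    qed
  qed
  have prec: "precedes w = precedes w'"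
    using sub[of w w'] sub[of w' w] eq cnt by (intro ext) metis
  have "map (occurrence w) [0..<length w] = map (occurrence w') [0..<length w']"
  proof (rule sorted_wrt_unique)
    show "sorted_wrt (precedes w) (map (occurrence w) [0..<length w])"
      by (rule sorted_wrt_precedes)
    show "sorted_wrt (precedes w) (map (occurrence w') [0..<length w'])"
      unfolding prec by (rule sorted_wrt_precedes)
    show "set (map (occurrence w) [0..<length w]) = set (map (occurrence w') [0..<length w'])"
      using occurrence_image[of w] occurrence_image[of w'] cnt
      by (simp add: atLeast0LessThan)
  qed (rule precedes_asym)
  then have "map (fst \<circ> occurrence w) [0..<length w] = map (fst \<circ> occurrence w') [0..<length w']"
    by (metis map_map)
  then show "w = w'"
    by (simp add: comp_def map_nth)
qed

text \<open>For words containing every letter \<open>m\<close> times this is avoidance of the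
  subwords \<open>a\<close>, \<open>c\<close>, \<open>a\<close> with \<open>a < c\<close>: no larger
  letter separates two copies of \<open>a\<close>.\<close>

definition blockwise :: "nat \<Rightarrow> nat list \<Rightarrow> bool" where
  "blockwise m w \<longleftrightarrow> (\<forall>a c i j k. ((a, i), (c, j)) \<in> coinv w \<longrightarrow> 1 \<le> k \<longrightarrow> k \<le> m \<longrightarrow> ((a, k), (c, j)) \<in> coinv w)"

text \<open>The last copy of \<open>a\<close> represents its block. The definition is also applied
  to words that are not blockwise, in order to follow metasylvester classes.\<close>

definition table_of :: "nat \<Rightarrow> nat list \<Rightarrow> (nat \<times> nat \<times> nat) set" where
  "table_of m w = {(a, c, j). ((a, m), (c, j)) \<in> coinv w}"

context
  fixes m n :: nat and w
  assumes w: "w \<in> m_perms m n"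
begin

lemma coinv_range:
  assumes "((a, i), (c, j)) \<in> coinv w"
  shows "1 \<le> a" "a < c" "c \<le> n" "1 \<le> i" "i \<le> m" "1 \<le> j" "j \<le> m"
proof -
  have "precedes w (c, j) (a, i)" "a < c"
    using assms by (auto simp: coinv_iff)
  then show "1 \<le> a" "a < c" "c \<le> n" "1 \<le> i" "i \<le> m" "1 \<le> j" "j \<le> m"
    using precedes_in[of w "(c, j)" "(a, i)"] w[unfolded m_perms_iff, rule_format, of a]
      w[unfolded m_perms_iff, rule_format, of c]
    by (auto split: if_splits)
qed

lemma coinv_mono:
  assumes "((a, i), (c, j)) \<in> coinv w" "i \<le> i'" "i' \<le> m" "1 \<le> j'" "j' \<le> j"
  shows "((a, i'), (c, j')) \<in> coinv w"
proof -
  note r = coinv_range[OF assms(1)]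
  have cnt: "count_list w a = m" "count_list w c = m"
    using w[unfolded m_perms_iff, rule_format] r by auto
  have *: "precedes w (c, j) (a, i)" "a < c"
    using assms by (auto simp: coinv_iff)
  have "precedes w (c, j) (a, i')"
    using * precedes_same_letter[of i i' w a] assms(2,3) r cnt precedes_trans[of w "(c, j)" "(a, i)"]
    by (cases "i = i'") auto
  then have "precedes w (c, j') (a, i')"
    using precedes_same_letter[of j' j w c] assms r cnt precedes_trans[of w "(c, j')" "(c, j)"]
    by (cases "j = j'") auto
  with * show ?thesis by (simp add: coinv_iff)
qed

lemma coinv_trans:
  "((a, i), (b, k)) \<in> coinv w \<Longrightarrow> ((b, k), (c, j)) \<in> coinv w \<Longrightarrow> ((a, i), (c, j)) \<in> coinv w"
  unfolding coinv_iff using precedes_trans by force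

lemma coinv_cotrans:
  assumes "((a, i), (c, j)) \<in> coinv w" "a < b" "b < c" "1 \<le> k" "k \<le> m"
  shows "((a, i), (b, k)) \<in> coinv w \<or> ((b, k), (c, j)) \<in> coinv w"
proof (rule ccontr)
  assume n: "\<not> ?thesis"
  note r = coinv_range[OF assms(1)]
  have "precedes w (a, i) (b, k)" "precedes w (b, k) (c, j)"
    using precedes_total[of i w a k b] precedes_total[of k w b j c] n assms r
      w[unfolded m_perms_iff, rule_format] by (auto simp: coinv_iff)
  then have "precedes w (a, i) (c, j)" by (rule precedes_trans)
  then show False
    using assms(1) precedes_asym unfolding coinv_iff by blast
qed

lemma table_of_in_tables:
  assumes "1 \<le> m" and bw: "blockwise m w"
  shows "table_of m w \<in> tables m n"
proof (rule tablesI)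
  show "table_of m w \<subseteq> triples m n"
    using coinv_range by (force simp: table_of_def triples_def)
  show "(a, c, k) \<in> table_of m w" if "(a, c, j) \<in> table_of m w" "1 \<le> k" "k \<le> j" for a c j k
    using that coinv_mono[of a m c j m k] by (simp add: table_of_def)
  show "(a, c, j) \<in> table_of m w" if "(a, b, i) \<in> table_of m w" "(b, c, j) \<in> table_of m w" for a b c i j
  proof -
    have *: "((a, m), (b, i)) \<in> coinv w" "((b, m), (c, j)) \<in> coinv w"
      using that by (auto simp: table_of_def)
    \<comment> \<open>Transitivity is where blocks matter: copy \<open>j\<close> of \<open>c\<close>
      precedes the last \<open>b\<close>, hence also the copy \<open>i\<close> of \<open>b\<close>
      that precedes the last \<open>a\<close>.\<close>
    then have "((b, i), (c, j)) \<in> coinv w"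
      using bw coinv_range[OF *(1)] unfolding blockwise_def by blast
    then show ?thesis
      using coinv_trans * by (auto simp: table_of_def)
  qed
  show "(b, c, j) \<in> table_of m w \<or> (a, b, m) \<in> table_of m w"
    if "(a, c, j) \<in> table_of m w" "a < b" "b < c" for a b c j
    using that coinv_cotrans[of a m c j b m] assms by (auto simp: table_of_def)
qed

end


text \<open>The table prescribes a total asymmetric relation \<open>r\<close> on occurrences, and
  sorting by it yields the word. Transitivity amounts to the absence of 3-cycles. Read from its
  smallest letter, a 3-cycle is contradictory at once if that letter is repeated, and otherwise
  violates one of the three conditions on tables.\<close>

lemma word_of_table:
  assumes X: "X \<in> tables m n" and "1 \<le> m"
  obtains w where "w \<in> m_perms m n"
    "coinv w = {((a, i), (c, j)) | a c i j. (a, c, j) \<in> X \<and> 1 \<le> i \<and> i \<le> m}"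
proof -
  let ?A = "{1..n} \<times> {1..m}"
  define r where "r y x \<longleftrightarrow> (case (y, x) of ((b, i), (c, j)) \<Rightarrow>
      if b = c then i < j else if c < b then (c, b, i) \<in> X else (b, c, j) \<notin> X)"
    for y x :: "nat \<times> nat"
  have asym: "r y x \<Longrightarrow> \<not> r x y" for y x
    by (auto simp: r_def split: prod.splits if_splits)
  have total: "y \<noteq> x \<Longrightarrow> r y x \<or> r x y" for y x
    by (auto simp: r_def split: prod.splits if_splits)
  have trans: "r z x" if in_A: "z \<in> ?A" "y \<in> ?A" "x \<in> ?A" and zy: "r z y" and yx: "r y x" for x y z
  proof (rule ccontr)
    assume nzx: "\<not> r z x"
    obtain a i b k c j where xyz: "x = (a, i)" "y = (b, k)" "z = (c, j)"
      by (metis prod.exhaust)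
    have zx: "r x z"
      using nzx total[of z x] asym zy yx by blast
    have cyc: False if "r (a, i) (c, j)" "r (c, j) (b, k)" "r (b, k) (a, i)" "a \<le> b" "a \<le> c"
      "i \<le> m" "1 \<le> i" "k \<le> m" "1 \<le> k" "j \<le> m" "1 \<le> j" for a b c i j k
    proof -
      consider "a = b" "a = c" | "a = b" "a < c" | "a = c" "a < b" | "a < b" "b = c" | "a < b" "b < c" | "a < c" "c < b"
        using \<open>a \<le> b\<close> \<open>a \<le> c\<close> by atomize_elim arith
      then show False
      proof cases
        case 4
        then show False using that tables_down[OF X, of a b k j] by (auto simp: r_def)
      next
        case 5
        then show False using that tables_trans[OF X, of a b k c j] by (auto simp: r_def)
      next
        case 6
        then have "(a, b, k) \<in> X" "(c, b, k) \<notin> X" "(a, c, j) \<notin> X"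
          using that by (auto simp: r_def)
        then have "(a, c, m) \<in> X"
          using tables_cotrans[OF X, of a b k c] 6 by auto
        then show False
          using \<open>(a, c, j) \<notin> X\<close> tables_down[OF X] that by blast
      qed (use that in \<open>auto simp: r_def\<close>)
    qed
    have "a \<le> b \<and> a \<le> c \<or> b \<le> a \<and> b \<le> c \<or> c \<le> a \<and> c \<le> b" by linarith
    then show False
      using cyc[of a i c j b k] cyc[of b k a i c j] cyc[of c j b k a i] in_A zx zy yx xyz by auto
  qed
  have "\<exists>ws. distinct ws \<and> set ws = ?A \<and> sorted_wrt r ws"
  proof (rule sorted_wrt_exists)
    show "r x z" if "x \<in> ?A" "y \<in> ?A" "z \<in> ?A" "r x y" "r y z" for x y z
      using that by (rule trans)
    show "r x y \<or> r y x" if "x \<in> ?A" "y \<in> ?A" "x \<noteq> y" for x y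
      using that(3) by (rule total)
  qed simp
  then obtain ws where ws: "distinct ws" "set ws = ?A" "sorted_wrt r ws"
    by blast
  define w where "w = map fst ws"
  have count: "count_list (map fst us) a = card {j. (a, j) \<in> set us}" if "distinct us"
    for us :: "(nat \<times> nat) list" and a
  proof -
    have "count_list (map fst us) a = length (filter (\<lambda>x. fst x = a) us)"
      by (induction us) auto
    also have "\<dots> = card (set (filter (\<lambda>x. fst x = a) us))"
      using that by (intro distinct_card[symmetric]) simp
    also have "set (filter (\<lambda>x. fst x = a) us) = Pair a ` {j. (a, j) \<in> set us}"
      by force
    finally show ?thesis
      by (simp add: card_image inj_on_def)
  qed
  have "{j. (a, j) \<in> ?A} = (if 1 \<le> a \<and> a \<le> n then {1..m} else {})" for a by auto
  then have perm: "w \<in> m_perms m n"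
    using count[OF ws(1)] ws(2) by (simp add: m_perms_iff w_def)
  \<comment> \<open>Sorting puts the copies of \<open>b\<close> in the order of their ranks, so
    those up to position \<open>p\<close> are exactly the ranks \<open>1\<close> to
    \<open>i\<close>, and ranks agree with occurrence numbers.\<close>
  have occ: "occurrence w p = ws ! p" if p: "p < length ws" for p
  proof -
    obtain b i where bi: "ws ! p = (b, i)" by fastforce
    have bi_A: "(b, i) \<in> ?A"
      using ws(2) p bi nth_mem by fastforce
    have "(b, j) \<in> set (take (Suc p) ws) \<longleftrightarrow> j \<in> {1..i}" for j
    proof
      assume "(b, j) \<in> set (take (Suc p) ws)"
      then obtain q where q: "q \<le> p" "ws ! q = (b, j)"
        using p by (auto simp: in_set_conv_nth less_Suc_eq_le)
      then have "q = p \<or> r (b, j) (b, i)"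
        using ws(3) p bi unfolding sorted_wrt_iff_nth_less by (metis le_neq_implies_less)
      moreover have "(b, j) \<in> ?A"
        using q p ws(2) nth_mem by (metis le_less_trans)
      ultimately show "j \<in> {1..i}"
        using q bi by (auto simp: r_def)
    next
      assume j: "j \<in> {1..i}"
      then have "(b, j) \<in> set ws" using bi_A ws(2) by auto
      then obtain q where q: "q < length ws" "ws ! q = (b, j)"
        by (auto simp: in_set_conv_nth)
      have "\<not> p < q"
      proof
        assume "p < q"
        then have "r (b, i) (b, j)"
          using ws(3) q bi unfolding sorted_wrt_iff_nth_less by metis
        then show False using j by (auto simp: r_def)
      qed
      then have "q < length (take (Suc p) ws)" "take (Suc p) ws ! q = (b, j)"
        using q p by auto
      then show "(b, j) \<in> set (take (Suc p) ws)"
        by (metis nth_mem)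
    qed
    then have "{j. (b, j) \<in> set (take (Suc p) ws)} = {1..i}"
      by blast
    then have "count_list (map fst (take (Suc p) ws)) b = i"
      using count[of "take (Suc p) ws" b] ws(1) by simp
    then show ?thesis
      using p bi by (simp add: occurrence_def w_def take_map)
  qed
  have prec: "precedes w y x \<longleftrightarrow> x \<in> ?A \<and> y \<in> ?A \<and> r y x" for x y
  proof
    assume "precedes w y x"
    then obtain p q where pq: "p < q" "q < length ws" "y = ws ! p" "x = ws ! q"
      using occ by (auto simp: precedes_def w_def)
    then have "x \<in> set ws" "y \<in> set ws" by auto
    then show "x \<in> ?A \<and> y \<in> ?A \<and> r y x"
      using pq ws(2,3) by (auto simp: sorted_wrt_iff_nth_less)
  next
    assume *: "x \<in> ?A \<and> y \<in> ?A \<and> r y x"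
    then have "x \<in> set ws" "y \<in> set ws"
      using ws(2) by auto
    then obtain p q where pq: "p < length ws" "ws ! p = y" "q < length ws" "ws ! q = x"
      by (auto simp: in_set_conv_nth)
    have "\<not> q < p"
      using sorted_wrt_nth_less[OF ws(3), of q p] pq * asym[of x y] by auto
    moreover have "x \<noteq> y"
      using * asym[of x x] by auto
    then have "p \<noteq> q"
      using pq by auto
    ultimately have "p < q" by simp
    then show "precedes w y x"
      using occ[of p] occ[of q] pq by (auto simp: precedes_def w_def)
  qed
  have "((a, i), (c, j)) \<in> coinv w \<longleftrightarrow> (a, c, j) \<in> X \<and> 1 \<le> i \<and> i \<le> m" for a i c j
    unfolding coinv_iff prec using tables_range[OF X, of a c j] by (auto simp: r_def)
  then have "coinv w = {((a, i), (c, j)) | a c i j. (a, c, j) \<in> X \<and> 1 \<le> i \<and> i \<le> m}"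
    by auto
  with perm show ?thesis by (rule that)
qed

lemma table_of_word:
  assumes "coinv w = {((a, i), (c, j)) | a c i j. (a, c, j) \<in> X \<and> 1 \<le> i \<and> i \<le> m}" "1 \<le> m"
  shows "blockwise m w" "table_of m w = X"
  using assms(2) unfolding blockwise_def table_of_def assms(1) by auto

lemma coinv_blockwise:
  assumes "w \<in> m_perms m n" "blockwise m w"
  shows "coinv w = {((a, i), (c, j)) | a c i j. (a, c, j) \<in> table_of m w \<and> 1 \<le> i \<and> i \<le> m}"
proof -
  have "((a, i), (c, j)) \<in> coinv w \<longleftrightarrow> (a, c, j) \<in> table_of m w \<and> 1 \<le> i \<and> i \<le> m" for a c i j
    using assms(2) coinv_range[OF assms(1), of a i c j] coinv_range[OF assms(1), of a m c j]
    unfolding blockwise_def table_of_def by (auto simp del: One_nat_def)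
  then show ?thesis by auto
qed

section \<open>Metasylvester steps and an invariant of their classes\<close>

lemma precedes_swap:
  assumes "a \<noteq> c" "precedes (u @ [a, c] @ v) y x"
  shows "(y, x) = ((a, Suc (count_list u a)), (c, Suc (count_list u c))) \<or> precedes (u @ [c, a] @ v) y x"
proof -
  let ?k = "length u"
  define f where "f r = (if r = ?k then Suc ?k else if r = Suc ?k then ?k else r)" for r
  have occ1: "occurrence (u @ [a, c] @ v) ?k = (a, Suc (count_list u a))"
    and occ2: "occurrence (u @ [a, c] @ v) (Suc ?k) = (c, Suc (count_list u c))" if "a \<noteq> c" for a c
    using occurrence_append_length[of u a "c # v"] occurrence_append_length[of "u @ [a]" c v] that
    by auto
  have occ: "occurrence (u @ [a, c] @ v) r = occurrence (u @ [c, a] @ v) (f r)" for r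
  proof -
    consider "r < ?k" | "r = ?k" | "r = Suc ?k" | i where "r = i + Suc (Suc ?k)"
      by atomize_elim presburger
    then show ?thesis
    proof cases
      case 4
      then show ?thesis by (simp add: occurrence_def f_def nth_append numeral_3_eq_3)
    qed (use assms(1) occ1 occ2 in \<open>auto simp: f_def occurrence_append_left\<close>)
  qed
  from assms(2) obtain p q where pq: "p < q" "q < length (u @ [a, c] @ v)"
    "y = occurrence (u @ [a, c] @ v) p" "x = occurrence (u @ [a, c] @ v) q"
    by (auto simp: precedes_def)
  show ?thesis
  proof (cases "p = ?k \<and> q = Suc ?k")
    case True
    then show ?thesis using pq occ1 occ2 assms(1) by simp
  next
    case False
    then have "f p < f q" "f q < length (u @ [c, a] @ v)"
      using pq by (auto simp: f_def)
    then show ?thesis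
      using occ pq unfolding precedes_def by blast
  qed
qed

text \<open>Exchanging two distinct adjacent letters renumbers no occurrence and reverses the order
  of that single pair.\<close>

lemma coinv_swap:
  fixes a c :: nat and u :: "nat list"
  assumes "a < c"
  defines "new \<equiv> ((a, Suc (count_list u a)), (c, Suc (count_list u c)))"
  shows "coinv (u @ [c, a] @ v) = insert new (coinv (u @ [a, c] @ v))"
    and "new \<notin> coinv (u @ [a, c] @ v)"
proof -
  have "precedes (u @ [x, y] @ v) (x, Suc (count_list u x)) (y, Suc (count_list u y))" if "x \<noteq> y" for x y
    using occurrence_append_length[of u x "y # v"] occurrence_append_length[of "u @ [x]" y v] that
    unfolding precedes_def by (intro exI[of _ "length u"] exI[of _ "Suc (length u)"]) auto
  then have new: "precedes (u @ [c, a] @ v) (snd new) (fst new)" "precedes (u @ [a, c] @ v) (fst new) (snd new)"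
    using assms by auto
  show "coinv (u @ [c, a] @ v) = insert new (coinv (u @ [a, c] @ v))"
  proof (intro Set.set_eqI iffI)
    fix t assume t: "t \<in> coinv (u @ [c, a] @ v)"
    obtain x y where xy: "t = (x, y)" by (cases t)
    then show "t \<in> insert new (coinv (u @ [a, c] @ v))"
      using t assms precedes_swap[of c a u v y x] by (auto simp: coinv_iff)
  next
    fix t assume t: "t \<in> insert new (coinv (u @ [a, c] @ v))"
    obtain x y where xy: "t = (x, y)" by (cases t)
    then show "t \<in> coinv (u @ [c, a] @ v)"
      using t new(1) assms precedes_swap[of a c u v y x] by (auto simp: coinv_iff)
  qed
  show "new \<notin> coinv (u @ [a, c] @ v)"
    using new(2) precedes_asym unfolding assms coinv_iff by auto
qed

lemma precedes_before:
  assumes "b \<in> set u"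
  shows "precedes (u @ a # v) (b, 1) (a, Suc (count_list u a))"
proof -
  obtain u1 u2 where u: "u = u1 @ b # u2" "b \<notin> set u1"
    using assms by (meson split_list_first)
  then have "occurrence (u @ a # v) (length u1) = (b, 1)"
    using occurrence_append_length[of u1 b "u2 @ a # v"] by simp
  then show ?thesis
    using u occurrence_append_length[of u a v] unfolding precedes_def
    by (intro exI[of _ "length u1"] exI[of _ "length u"]) auto
qed

lemma precedes_after:
  assumes "b \<in> set v"
  shows "precedes (u @ a # v) (a, Suc (count_list u a)) (b, count_list (u @ a # v) b)"
proof -
  obtain v1 v2 where v: "v = v1 @ b # v2" "b \<notin> set v2"
    using assms by (meson split_list_last)
  then have "occurrence (u @ a # v) (length (u @ a # v1)) = (b, count_list (u @ a # v) b)"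
    using occurrence_append_length[of "u @ a # v1" b v2] by simp
  then show ?thesis
    using v occurrence_append_length[of u a v] unfolding precedes_def
    by (intro exI[of _ "length u"] exI[of _ "length (u @ a # v1)"]) auto
qed

text \<open>A step of the second kind moves \<open>a\<close> past \<open>c\<close> only in the presence of a \<open>b\<close> strictly between
  \<open>a\<close> and \<open>c\<close> such that the last \<open>a\<close> lies between the first and the last \<open>b\<close>. The part of the table
  over the pairs without such a \<open>b\<close> is therefore constant on metasylvester classes.\<close>

definition free :: "nat \<Rightarrow> (nat \<times> nat \<times> nat) set \<Rightarrow> nat \<Rightarrow> nat \<Rightarrow> bool" where
  "free m X a c \<longleftrightarrow> (\<forall>b. a < b \<and> b < c \<and> (a, b, 1) \<in> X \<longrightarrow> (a, b, m) \<in> X)"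

definition class_inv :: "nat \<Rightarrow> (nat \<times> nat \<times> nat) set \<Rightarrow> (nat \<times> nat) set \<times> (nat \<times> nat \<times> nat) set" where
  "class_inv m X = ({(a, c). free m X a c}, {(a, c, j) \<in> X. free m X a c})"

text \<open>The letter \<open>b\<close> already prevents every pair \<open>(a, c')\<close> with
  \<open>b < c'\<close> from being free, and the new entry can influence the freeness of such pairs
  only.\<close>

lemma class_inv_insert:
  assumes "a < b" "b < c" "(a, b, 1) \<in> X" "(a, b, m) \<notin> X"
  shows "class_inv m (insert (a, c, j) X) = class_inv m X"
proof -
  have not_free: "\<not> free m X a c'" "\<not> free m (insert (a, c, j) X) a c'" if "b < c'" for c'
    using assms that unfolding free_def by blast+
  have free: "free m (insert (a, c, j) X) a' c' = free m X a' c'" for a' c'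
  proof (cases "a' = a \<and> b < c'")
    case False
    then have "(a', b', k) \<in> insert (a, c, j) X \<longleftrightarrow> (a', b', k) \<in> X" if "b' < c'" for b' k
      using that assms(2) by auto
    then show ?thesis
      unfolding free_def by blast
  qed (use not_free in auto)
  have "\<not> free m X a c"
    using not_free assms(2) by simp
  then show ?thesis
    unfolding class_inv_def free by auto
qed

lemma metasylv_step_coinv:
  assumes "metasylv_step w w'"
  shows "coinv w \<subset> coinv w'"
  using assms
proof cases
  case (1 a c u v x)
  then show ?thesis using coinv_swap[of a c u "v @ [a] @ x"] by auto
next
  case (2 a b c u v x y)
  then show ?thesis using coinv_swap[of a c "u @ [b] @ v" "x @ [b] @ y"] by auto
qed

lemma metasylv_step_m_perms:
  assumes "metasylv_step w w'"
  shows "w \<in> m_perms m n \<longleftrightarrow> w' \<in> m_perms m n"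
proof -
  have "mset w = mset w'"
    using assms by cases auto
  then show ?thesis by (simp add: m_perms_def)
qed

text \<open>The table sees only last copies. A step of the first kind moves an \<open>a\<close> that
  is followed by another one, so the table is unchanged. A step of the second kind changes it only
  when the moved \<open>a\<close> is the last, and then this \<open>a\<close> lies between the first
  and the last \<open>b\<close>.\<close>

lemma metasylv_step_class_inv:
  assumes "metasylv_step w w'" "w \<in> m_perms m n"
  shows "class_inv m (table_of m w) = class_inv m (table_of m w')"
  using assms(1)
proof cases
  case (1 a c u v x)
  have "m = count_list w a"
    using assms(2)[unfolded m_perms_iff, rule_format, of a] 1(1) by (simp split: if_splits)
  then have "Suc (count_list u a) < m"
    using 1 by simp
  then have "table_of m w = table_of m w'"
    using coinv_swap[of a c u "v @ [a] @ x"] 1 by (auto simp: table_of_def)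
  then show ?thesis by simp
next
  case (2 a b c u v x y)
  let ?u = "u @ [b] @ v" and ?v = "x @ [b] @ y"
  have m: "count_list w a = m" "count_list w b = m"
    using assms(2)[unfolded m_perms_iff, rule_format, of a]
      assms(2)[unfolded m_perms_iff, rule_format, of b] 2(1) by (simp_all split: if_splits)
  have w: "w = ?u @ a # c # ?v"
    using 2 by simp
  have co: "coinv w' = insert ((a, Suc (count_list ?u a)), (c, Suc (count_list ?u c))) (coinv w)"
    using coinv_swap[of a c ?u ?v] 2 by simp
  show ?thesis
  proof (cases "Suc (count_list ?u a) = m")
    case True
    have "precedes w (b, 1) (a, m)" "precedes w (a, m) (b, m)"
      using precedes_before[of b ?u a "c # ?v"] precedes_after[of b "c # ?v" ?u a] True m
      unfolding w by auto
    then have "(a, b, 1) \<in> table_of m w" "(a, b, m) \<notin> table_of m w"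
      using \<open>a < b\<close> precedes_asym by (auto simp: table_of_def coinv_iff)
    moreover have "table_of m w' = insert (a, c, Suc (count_list ?u c)) (table_of m w)"
      using co True by (auto simp: table_of_def)
    ultimately show ?thesis
      using class_inv_insert[of a b c "table_of m w" m] 2 by simp
  next
    case False
    then have "table_of m w = table_of m w'"
      using co by (auto simp: table_of_def)
    then show ?thesis by simp
  qed
qed

lemma metasylv_class_inv:
  assumes "metasylv w w'" "w \<in> m_perms m n"
  shows "w' \<in> m_perms m n \<and> class_inv m (table_of m w') = class_inv m (table_of m w)"
  using assms(1)
proof (induction rule: equivclp_induct)
  case (step y z)
  then show ?case
    using metasylv_step_m_perms metasylv_step_class_inv by metis
qed (use assms in auto)

lemma class_inv_eqD:
  assumes "class_inv m X = class_inv m Y"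
  shows "free m X = free m Y" "free m X a c \<Longrightarrow> (a, c, j) \<in> X \<longleftrightarrow> (a, c, j) \<in> Y"
proof -
  have "{(a, c). free m X a c} = {(a, c). free m Y a c}"
    and eq: "{(a, c, j) \<in> X. free m X a c} = {(a, c, j) \<in> Y. free m Y a c}"
    using assms by (simp_all add: class_inv_def)
  then show free: "free m X = free m Y"
    by (auto simp: fun_eq_iff set_eq_iff)
  show "free m X a c \<Longrightarrow> (a, c, j) \<in> X \<longleftrightarrow> (a, c, j) \<in> Y"
    using eq unfolding free by blast
qed

text \<open>If \<open>(a, c)\<close> is not free for \<open>w'\<close>, take the least
  \<open>b\<close> below \<open>c\<close> such that the last \<open>a\<close> lies between the first
  and the last \<open>b\<close>. Minimality makes \<open>(a, b)\<close> free, so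
  \<open>(a, b, 1)\<close> transfers to \<open>w\<close>. As the last \<open>b\<close> follows the
  last \<open>a\<close>, an occurrence of \<open>c\<close> before that \<open>a\<close> also
  precedes that \<open>b\<close>; this narrower entry transfers by induction, and transitivity of
  the table of \<open>w\<close> combines the two.\<close>

lemma blockwise_greatest_in_class:
  assumes m: "1 \<le> m" and w: "w \<in> m_perms m n" "blockwise m w" and w': "w' \<in> m_perms m n"
    and inv: "class_inv m (table_of m w) = class_inv m (table_of m w')"
  shows "coinv w' \<subseteq> coinv w"
proof -
  let ?X = "table_of m w" and ?Y = "table_of m w'"
  note X = table_of_in_tables[OF w(1) m w(2)]
  have sub: "(a, c, j) \<in> ?X" if "(a, c, j) \<in> ?Y" for a c j
    using that
  proof (induction "c - a" arbitrary: a rule: less_induct)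
    case less
    show ?case
    proof (cases "free m ?Y a c")
      case True
      then show ?thesis
        using class_inv_eqD[OF inv] less.prems by metis
    next
      case False
      define P where "P b \<longleftrightarrow> a < b \<and> b < c \<and> (a, b, 1) \<in> ?Y \<and> (a, b, m) \<notin> ?Y" for b
      define b where "b = (LEAST b. P b)"
      have "\<exists>b. P b"
        using False by (auto simp: free_def P_def)
      then have b: "P b" "\<And>b'. b' < b \<Longrightarrow> \<not> P b'"
        unfolding b_def using LeastI_ex[of P] not_less_Least[of _ P] by blast+
      then have ab: "a < b" "b < c" "(a, b, 1) \<in> ?Y" "(a, b, m) \<notin> ?Y"
        by (auto simp: P_def)
      have "free m ?Y a b"
        using b ab(2) by (auto simp: free_def P_def)
      then have "(a, b, 1) \<in> ?X"
        using class_inv_eqD[OF inv] ab(3) by metis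
      moreover have "(b, c, j) \<in> ?Y"
        using coinv_cotrans[OF w', of a m c j b m] less.prems ab m by (auto simp: table_of_def)
      then have "(b, c, j) \<in> ?X"
        using less.hyps ab by auto
      ultimately show ?thesis
        using tables_trans[OF X] by blast
    qed
  qed
  show ?thesis
  proof clarify
    fix a i c j assume *: "((a, i), (c, j)) \<in> coinv w'"
    note r = coinv_range[OF w' *]
    have "(a, c, j) \<in> ?Y"
      using coinv_mono[OF w' *, of m j] r by (simp add: table_of_def)
    then show "((a, i), (c, j)) \<in> coinv w"
      using sub coinv_blockwise[OF w] r by auto
  qed
qed

text \<open>Shortening \<open>v\<close> removes inner copies of \<open>a\<close>. The first letter
  \<open>c > a\<close> of \<open>v\<close> is then preceded by the left \<open>a\<close>, giving a
  step of the first kind, or by some \<open>d < a\<close>, giving one of the second kind with the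
  two copies of \<open>a\<close> as the enclosing pair.\<close>

lemma metasylv_step_of_pattern:
  assumes "\<exists>c\<in>set v. a < c"
  shows "\<exists>w'. metasylv_step (u @ [a] @ v @ [a] @ x) w'"
  using assms
proof (induction v arbitrary: u x rule: length_induct)
  case (1 v)
  show ?case
  proof (cases "a \<in> set v")
    case True
    then obtain v1 v2 where v: "v = v1 @ a # v2"
      by (meson split_list)
    consider "\<exists>c\<in>set v1. a < c" | "\<exists>c\<in>set v2. a < c"
      using 1(2) v by auto
    then show ?thesis
    proof cases
      case 1
      then have "\<exists>w'. metasylv_step (u @ [a] @ v1 @ [a] @ (v2 @ [a] @ x)) w'"
        using "1.IH"[rule_format, of v1 u "v2 @ [a] @ x"] v by auto
      then show ?thesis using v by simp
    next
      case 2
      then have "\<exists>w'. metasylv_step ((u @ [a] @ v1) @ [a] @ v2 @ [a] @ x) w'"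
        using "1.IH"[rule_format, of v2 "u @ [a] @ v1" x] v by auto
      then show ?thesis using v by simp
    qed
  next
    case False
    obtain v1 c v2 where v: "v = v1 @ c # v2" "a < c" "\<forall>d\<in>set v1. \<not> a < d"
      using 1(2) by (rule split_list_first_propE)
    show ?thesis
    proof (cases v1 rule: rev_cases)
      case Nil
      then have eq: "u @ [a] @ v @ [a] @ x = u @ [a, c] @ v2 @ [a] @ x"
        using v(1) by simp
      show ?thesis
        unfolding eq using metasylv_step.intros(1)[OF v(2)] by blast
    next
      case (snoc v0 d)
      then have "d < a"
        using v False by (auto simp: less_le)
      have eq: "u @ [a] @ v @ [a] @ x = u @ [a] @ v0 @ [d, c] @ v2 @ [a] @ x"
        using v(1) snoc by simp
      show ?thesis
        unfolding eq using metasylv_step.intros(2)[OF \<open>d < a\<close> v(2)] by blast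
    qed
  qed
qed

lemma not_blockwise_step:
  assumes w: "w \<in> m_perms m n" and nb: "\<not> blockwise m w"
  shows "\<exists>w'. metasylv_step w w'"
proof -
  obtain a c i j k where *: "((a, i), (c, j)) \<in> coinv w" "1 \<le> k" "k \<le> m" "((a, k), (c, j)) \<notin> coinv w"
    using nb unfolding blockwise_def by blast
  note r = coinv_range[OF w *(1)]
  have "precedes w (c, j) (a, i)" "\<not> precedes w (c, j) (a, k)" "a < c"
    using * r by (auto simp: coinv_iff)
  moreover have "precedes w (a, k) (c, j)"
    using precedes_total[of k w a j c] calculation * r w[unfolded m_perms_iff, rule_format] by auto
  ultimately obtain p q q' s where pq: "p < q" "q < length w" "(a, k) = occurrence w p" "(c, j) = occurrence w q"
    "q' < s" "s < length w" "(c, j) = occurrence w q'" "(a, i) = occurrence w s"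
    unfolding precedes_def by blast
  then have "q' = q"
    using inj_on_occurrence[of w, THEN inj_onD, of q q'] by simp
  have wp: "w ! p = a" "w ! q = c" "w ! s = a"
    using pq by (metis fst_conv fst_occurrence)+
  let ?v = "drop (Suc p) (take s w)"
  have "take s w = take p w @ [a] @ ?v"
    using id_take_nth_drop[of p "take s w"] pq \<open>q' = q\<close> wp by (simp add: min_def)
  moreover have "w = take s w @ [a] @ drop (Suc s) w"
    using id_take_nth_drop[of s w] pq wp by simp
  ultimately have "w = take p w @ [a] @ ?v @ [a] @ drop (Suc s) w"
    by (metis append.assoc)
  moreover have "c \<in> set ?v"
  proof -
    have "?v ! (q - Suc p) = c" "q - Suc p < length ?v"
      using pq \<open>q' = q\<close> wp by auto
    then show ?thesis by (metis nth_mem)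
  qed
  ultimately show ?thesis
    using metasylv_step_of_pattern[of ?v a "take p w" "drop (Suc s) w"] \<open>a < c\<close> by metis
qed

text \<open>A word that is not blockwise admits an increasing step within its class, and a blockwise
  one dominates its whole class.\<close>

lemma metasylv_max_eq:
  assumes "1 \<le> m"
  shows "metasylv_max m n = {w \<in> m_perms m n. blockwise m w}"
proof (intro Set.set_eqI iffI)
  fix w assume "w \<in> metasylv_max m n"
  then have w: "w \<in> m_perms m n"
    and max: "\<And>w'. w' \<in> m_perms m n \<Longrightarrow> metasylv w w' \<Longrightarrow> coinv w \<subseteq> coinv w' \<Longrightarrow> w' = w"
    by (auto simp: metasylv_max_def)
  have "blockwise m w"
  proof (rule ccontr)
    assume "\<not> blockwise m w"
    then obtain w' where w': "metasylv_step w w'"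
      using not_blockwise_step[OF w] by blast
    then have "coinv w \<subset> coinv w'" "w' \<in> m_perms m n"
      using w metasylv_step_coinv metasylv_step_m_perms by blast+
    then show False
      using max[of w'] w' by auto
  qed
  with w show "w \<in> {w \<in> m_perms m n. blockwise m w}" by simp
next
  fix w assume "w \<in> {w \<in> m_perms m n. blockwise m w}"
  then have w: "w \<in> m_perms m n" "blockwise m w" by auto
  have "w' = w" if "w' \<in> m_perms m n" "metasylv w w'" "coinv w \<subseteq> coinv w'" for w'
  proof -
    have "coinv w' \<subseteq> coinv w"
      using metasylv_class_inv[OF that(2) w(1)] blockwise_greatest_in_class[OF assms w] that(1) by metis
    then show ?thesis
      using inj_on_coinv[THEN inj_onD, of w' w] that w by blast
  qed
  then show "w \<in> metasylv_max m n"
    using w by (auto simp: metasylv_max_def)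
qed

lemma table_of_iso:
  assumes "1 \<le> m"
  shows "bij_betw (table_of m) (metasylv_max m n) (tables m n)"
    and "\<And>w w'. w \<in> metasylv_max m n \<Longrightarrow> w' \<in> metasylv_max m n \<Longrightarrow>
      coinv w \<subseteq> coinv w' \<longleftrightarrow> table_of m w \<subseteq> table_of m w'"
proof -
  show mono: "coinv w \<subseteq> coinv w' \<longleftrightarrow> table_of m w \<subseteq> table_of m w'"
    if "w \<in> metasylv_max m n" "w' \<in> metasylv_max m n" for w w'
  proof
    assume "table_of m w \<subseteq> table_of m w'"
    then show "coinv w \<subseteq> coinv w'"
      using that coinv_blockwise[of w m n] coinv_blockwise[of w' m n] unfolding metasylv_max_eq[OF assms]
      by fastforce
  qed (auto simp: table_of_def)
  show "bij_betw (table_of m) (metasylv_max m n) (tables m n)"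
    unfolding bij_betw_def
  proof
    show "inj_on (table_of m) (metasylv_max m n)"
    proof (rule inj_onI)
      fix w w' assume *: "w \<in> metasylv_max m n" "w' \<in> metasylv_max m n" "table_of m w = table_of m w'"
      then have "coinv w = coinv w'"
        by (intro equalityI) (simp_all add: mono)
      then show "w = w'"
        using * inj_on_coinv[of m n, THEN inj_onD, of w w'] unfolding metasylv_max_eq[OF assms] by simp
    qed
    show "table_of m ` metasylv_max m n = tables m n"
    proof
      show "table_of m ` metasylv_max m n \<subseteq> tables m n"
        using table_of_in_tables[OF _ assms] unfolding metasylv_max_eq[OF assms] by blast
      show "tables m n \<subseteq> table_of m ` metasylv_max m n"
      proof
        fix X assume "X \<in> tables m n"
        then obtain w where "w \<in> m_perms m n"
          "coinv w = {((a, i), (c, j)) | a c i j. (a, c, j) \<in> X \<and> 1 \<le> i \<and> i \<le> m}"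
          by (rule word_of_table[OF _ assms])
        then show "X \<in> table_of m ` metasylv_max m n"
          using table_of_word[of w X m, OF _ assms] unfolding metasylv_max_eq[OF assms] by blast
      qed
    qed
  qed
qed

section \<open>Ballot paths and decreasing tables\<close>

definition row :: "(nat \<times> nat \<times> nat) set \<Rightarrow> nat \<Rightarrow> (nat \<times> nat) set" where
  "row X a = {(c, j). (a, c, j) \<in> X}"

text \<open>Reading a decreasing table as a path, \<open>row X a\<close> is the set of East steps before the North
  step labelled \<open>a\<close>, each named by the North step \<open>c\<close> it is matched with and its rank \<open>j\<close>
  among the \<open>m\<close> East steps matched with \<open>c\<close>. North steps are labelled \<open>n, \<dots>, 1\<close> from the
  bottom, and \<open>x a\<close> below counts the East steps before the one labelled \<open>a\<close>.\<close>

definition ballot_seq :: "nat \<Rightarrow> nat \<Rightarrow> (nat \<Rightarrow> nat) \<Rightarrow> bool" where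
  "ballot_seq m n x \<longleftrightarrow> (\<forall>a\<in>{1..n}. x a \<le> m * (n - a)) \<and> (\<forall>a\<ge>1. a < n \<longrightarrow> x (Suc a) \<le> x a)"

text \<open>Let North steps raise the level by \<open>m\<close> and East steps lower it by one. The
  inequality says that just before the North step \<open>b\<close> the level is at least
  \<open>j\<close> below the one just after the North step \<open>c\<close>, so \<open>j\<close>
  East steps have been matched with \<open>c\<close>. Ranging over all \<open>b \<ge> a\<close>
  records that this has happened at some moment before the step \<open>a\<close>.\<close>

definition seq_table :: "nat \<Rightarrow> nat \<Rightarrow> (nat \<Rightarrow> nat) \<Rightarrow> (nat \<times> nat \<times> nat) set" where
  "seq_table m n x =
     {(a, c, j) \<in> triples m n. \<exists>b\<ge>a. b < c \<and> x c + m * (c - 1 - b) + j \<le> x b}"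

lemma row_subset: "X \<in> tables m n \<Longrightarrow> row X a \<subseteq> {a<..n} \<times> {1..m}"
  using tables_range by (fastforce simp: row_def)

lemma finite_row: "X \<in> tables m n \<Longrightarrow> finite (row X a)"
  using row_subset finite_subset by (metis finite_SigmaI finite_atLeastAtMost finite_greaterThanAtMost)

lemma seq_table_cong:
  assumes "\<And>a. 1 \<le> a \<Longrightarrow> a \<le> n \<Longrightarrow> x a = y a"
  shows "seq_table m n x = seq_table m n y"
proof -
  have "(\<exists>b\<ge>a. b < c \<and> x c + m * (c - 1 - b) + j \<le> x b) \<longleftrightarrow>
      (\<exists>b\<ge>a. b < c \<and> y c + m * (c - 1 - b) + j \<le> y b)" if "(a, c, j) \<in> triples m n" for a c j
  proof -
    have "x b = y b" if "a \<le> b" "b \<le> c" for b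
      using assms that triplesD[OF \<open>(a, c, j) \<in> triples m n\<close>] by auto
    then show ?thesis
      using triplesD[OF that] by (metis less_imp_le order_refl)
  qed
  then have "(a, c, j) \<in> seq_table m n x \<longleftrightarrow> (a, c, j) \<in> seq_table m n y" for a c j
    unfolding seq_table_def mem_Collect_eq prod.case by blast
  then show ?thesis
    by auto
qed

text \<open>If \<open>(b, c, j)\<close> is missing, row \<open>b\<close> has room only for fewer
  than \<open>j\<close> entries of column \<open>c\<close>, the columns between, and, by
  cotransitivity, those entries beyond column \<open>c\<close> that are already in row
  \<open>c\<close>.\<close>

lemma row_card_upper:
  assumes X: "X \<in> tables m n" and t: "(b, c, j) \<in> triples m n" "(b, c, j) \<notin> X"
  shows "card (row X b) < card (row X c) + m * (c - 1 - b) + j"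
proof -
  note r = triplesD[OF t(1)]
  let ?R = "row X c \<union> {b<..<c} \<times> {1..m} \<union> {c} \<times> {1..<j}"
  have "row X b \<subseteq> ?R"
  proof (rule subrelI, rule ccontr)
    fix g i assume "(g, i) \<in> row X b" and gi: "(g, i) \<notin> ?R"
    then have X_gi: "(b, g, i) \<in> X" by (simp add: row_def)
    note r' = tables_range[OF X X_gi]
    have "(b, c, m) \<notin> X"
      using tables_down[OF X, of b c m j] t r by auto
    then have "\<not> c < g"
      using tables_cotrans[OF X X_gi, of c] gi r by (auto simp: row_def)
    moreover have "g \<noteq> c"
      using tables_down[OF X, of b c i j] X_gi gi t r r' by auto
    ultimately show False
      using r' gi by auto
  qed
  then have "card (row X b) \<le> card ?R"
    using finite_row[OF X] by (intro card_mono) auto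
  also have "\<dots> \<le> card (row X c) + card ({b<..<c} \<times> {1..m}) + card ({c} \<times> {1..<j})"
    by (meson add_le_mono1 card_Un_le order_trans)
  also have "\<dots> < card (row X c) + m * (c - 1 - b) + j"
    using r by (simp add: card_cartesian_product mult.commute)
  finally show ?thesis .
qed

text \<open>For a last entry the corresponding three parts, now with \<open>j\<close> ranks of
  column \<open>c\<close>, are all contained in row \<open>b\<close>: decreasingness gives row
  \<open>c\<close>, cotransitivity fills the columns between. The parts are disjoint, so their sizes
  add up.\<close>

lemma row_card_lower:
  assumes X: "X \<in> dec_tables m n" and b: "(b, c, j) \<in> last_entries X"
  shows "card (row X c) + m * (c - 1 - b) + j \<le> card (row X b)"
proof -
  note XT = dec_tablesD[OF X]
  have bX: "(b, c, j) \<in> X" using b by (simp add: last_entries_def)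
  note r = tables_range[OF XT bX]
  have "row X c \<subseteq> row X b"
    using dec_tables_dec[OF X] r by (auto simp: row_def)
  moreover have "{b<..<c} \<times> {1..m} \<subseteq> row X b"
  proof (rule subrelI)
    fix d i assume di: "(d, i) \<in> {b<..<c} \<times> {1..m}"
    then have "(b, d, m) \<in> X"
      using tables_cotrans[OF XT bX, of d] b by (auto simp: last_entries_def)
    then show "(d, i) \<in> row X b"
      using tables_down[OF XT] di by (auto simp: row_def)
  qed
  moreover have "{c} \<times> {1..j} \<subseteq> row X b"
    using tables_down[OF XT bX] by (auto simp: row_def)
  ultimately have "row X c \<union> {b<..<c} \<times> {1..m} \<union> {c} \<times> {1..j} \<subseteq> row X b" by simp
  then have "card (row X c \<union> {b<..<c} \<times> {1..m} \<union> {c} \<times> {1..j}) \<le> card (row X b)"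
    using finite_row[OF XT] by (intro card_mono)
  moreover have "card (row X c \<union> {b<..<c} \<times> {1..m} \<union> {c} \<times> {1..j}) =
      card (row X c) + card ({b<..<c} \<times> {1..m}) + card ({c} \<times> {1..j})"
    using row_subset[OF XT, of c] finite_row[OF XT, of c]
    by (subst card_Un_disjoint | force)+
  ultimately show ?thesis
    by (simp add: card_cartesian_product mult.commute)
qed

text \<open>The upper bound turns the inequality at \<open>b\<close> into membership of
  \<open>(b, c, j)\<close>; the lower bound supplies the inequality at the last entry belonging to a
  given one.\<close>

lemma seq_table_row:
  assumes X: "X \<in> dec_tables m n"
  shows "seq_table m n (\<lambda>a. card (row X a)) = X"
proof (intro equalityI subsetI)
  note XT = dec_tablesD[OF X]
  fix t assume t: "t \<in> seq_table m n (\<lambda>a. card (row X a))"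
  obtain a c j where [simp]: "t = (a, c, j)" by (cases t)
  obtain b where tr: "(a, c, j) \<in> triples m n" and b: "a \<le> b" "b < c"
    "card (row X c) + m * (c - 1 - b) + j \<le> card (row X b)"
    using t by (auto simp: seq_table_def)
  have "(b, c, j) \<in> X"
    using row_card_upper[OF XT, of b c j] b triplesD[OF tr] by (force simp: triples_def)
  then show "t \<in> X"
    using dec_tables_dec[OF X] b triplesD[OF tr] by auto
next
  note XT = dec_tablesD[OF X]
  fix t assume t: "t \<in> X"
  obtain a c j where [simp]: "t = (a, c, j)" by (cases t)
  obtain b where "a \<le> b" "b < c" "(b, c, j) \<in> last_entries X"
    using last_entry_above[OF XT, of a c j] t by auto
  then show "t \<in> seq_table m n (\<lambda>a. card (row X a))"
    using row_card_lower[OF X] t tables_triples[OF XT] by (auto simp: seq_table_def)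
qed

lemma ballot_seq_row:
  assumes X: "X \<in> dec_tables m n"
  shows "ballot_seq m n (\<lambda>a. card (row X a))"
  unfolding ballot_seq_def
proof (intro conjI ballI allI impI)
  note XT = dec_tablesD[OF X]
  show "card (row X a) \<le> m * (n - a)" for a
    using card_mono[OF _ row_subset[OF XT, of a]] by (simp add: card_cartesian_product mult.commute)
  show "card (row X (Suc a)) \<le> card (row X a)" if "1 \<le> a" for a
    using dec_tables_dec[OF X] that finite_row[OF XT] by (intro card_mono) (auto simp: row_def)
qed

lemma seq_table_in_dec_tables: "seq_table m n x \<in> dec_tables m n"
proof -
  have dec: "(a, c, j) \<in> seq_table m n x" if h: "(b, c, j) \<in> seq_table m n x" "1 \<le> a" "a \<le> b" for a b c j
  proof -
    obtain d where "(b, c, j) \<in> triples m n" "b \<le> d" "d < c" "x c + m * (c - 1 - d) + j \<le> x d"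
      using h(1) by (auto simp: seq_table_def)
    then show ?thesis
      using h(2,3) by (auto simp: seq_table_def triples_def intro!: exI[of _ d])
  qed
  have "seq_table m n x \<in> tables m n"
  proof (rule tablesI)
    show "seq_table m n x \<subseteq> triples m n"
      by (auto simp: seq_table_def)
    show "(a, c, k) \<in> seq_table m n x" if "(a, c, j) \<in> seq_table m n x" "1 \<le> k" "k \<le> j" for a c j k
      using that by (force simp: seq_table_def triples_def)
    show "(a, c, j) \<in> seq_table m n x" if "(a, b, i) \<in> seq_table m n x" "(b, c, j) \<in> seq_table m n x"
      for a b c i j
      using that dec[of b c j a] by (auto simp: seq_table_def triples_def)
    show "(b, c, j) \<in> seq_table m n x \<or> (a, b, m) \<in> seq_table m n x"
      if h: "(a, c, j) \<in> seq_table m n x" "a < b" "b < c" for a b c j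
    proof -
      obtain d where tr: "(a, c, j) \<in> triples m n" and d: "a \<le> d" "d < c" "x c + m * (c - 1 - d) + j \<le> x d"
        using h by (auto simp: seq_table_def)
      note r = triplesD[OF tr]
      consider "b \<le> d" | "d < b" "x c + m * (c - 1 - b) + j \<le> x b" | "d < b" "x b < x c + m * (c - 1 - b) + j"
        by linarith
      then show ?thesis
      proof cases
        \<comment> \<open>Subtracting the failed inequality at \<open>b\<close> from the one at
          \<open>d\<close> leaves \<open>m\<close> East steps for \<open>b\<close>, so
          \<open>(a, b, m)\<close> is an entry with witness \<open>d\<close>.\<close>
        case 3
        have "c - 1 - d = (c - 1 - b) + (b - 1 - d) + 1"
          using 3 h by simp
        then have "m * (c - 1 - d) = m * (c - 1 - b) + m * (b - 1 - d) + m"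
          by (simp only: distrib_left mult_1_right)
        then have "x b + m * (b - 1 - d) + m \<le> x d"
          using 3 d by linarith
        then show ?thesis
          using 3 d r h by (auto simp: seq_table_def triples_def)
      qed (use d r h in \<open>auto simp: seq_table_def triples_def\<close>)
    qed
  qed
  then show ?thesis
    using dec by (auto simp: dec_tables_def)
qed

text \<open>Let \<open>c\<close> be the North step matched, in the path of \<open>y\<close>, with
  the East step right before the North step \<open>a\<close>, and let \<open>j\<close> be its rank.
  The entry \<open>(a, c, j)\<close> tells the tables apart: it is missing for \<open>x\<close>
  because the sequences agree above \<open>a\<close> and \<open>c\<close> is minimal.\<close>

lemma seq_table_separates:
  assumes x: "ballot_seq m n x" and y: "ballot_seq m n y" and a: "1 \<le> a" "a \<le> n" "x a < y a"
    and eq: "\<And>b. a < b \<Longrightarrow> b \<le> n \<Longrightarrow> x b = y b"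
  shows "seq_table m n x \<noteq> seq_table m n y"
proof -
  define P where "P c \<longleftrightarrow> a < c \<and> c \<le> n \<and> y a \<le> x c + m * (c - a)" for c
  define c where "c = (LEAST c. P c)"
  have "y a \<le> m * (n - a)"
    using y a by (auto simp: ballot_seq_def)
  moreover from this have "a \<noteq> n" using a by auto
  ultimately have "P n" using a by (auto simp: P_def)
  then have c: "P c" "\<And>b. b < c \<Longrightarrow> \<not> P b"
    unfolding c_def using LeastI[of P] not_less_Least[of _ P] by blast+
  then have ac: "a < c" "c \<le> n" "y a \<le> x c + m * (c - a)"
    by (auto simp: P_def)
  have between: "x b + m * (b - a) < y a" if "a < b" "b < c" for b
    using c(2)[of b] that ac by (auto simp: P_def)
  \<comment> \<open>This makes the rank \<open>j\<close> positive. It comes from minimality of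
    \<open>c\<close> applied to \<open>c - 1\<close>, or from \<open>x a < y a\<close> if
    \<open>c\<close> is \<open>Suc a\<close>.\<close>
  have low: "x c + m * (c - 1 - a) < y a"
  proof (cases "c = Suc a")
    case True
    then show ?thesis
      using x a ac by (auto simp: ballot_seq_def)
  next
    case False
    then have "x (c - 1) + m * (c - 1 - a) < y a"
      using between[of "c - 1"] ac by auto
    moreover have "x (Suc (c - 1)) \<le> x (c - 1)"
      using x[unfolded ballot_seq_def, THEN conjunct2, rule_format, of "c - 1"] ac a by simp
    ultimately show ?thesis using ac by simp
  qed
  define j where "j = y a - (x c + m * (c - 1 - a))"
  have "m * (c - a) = m * (c - 1 - a) + m"
    using ac by (metis Suc_diff_Suc diff_Suc_eq_diff_pred mult_Suc_right add.commute)
  then have j: "1 \<le> j" "j \<le> m" "y a = x c + m * (c - 1 - a) + j"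
    using low ac by (auto simp: j_def)
  have tr: "(a, c, j) \<in> triples m n"
    using a ac j by (simp add: triples_def)
  have "(a, c, j) \<in> seq_table m n y"
    using tr j ac eq by (auto simp: seq_table_def)
  moreover have "(a, c, j) \<notin> seq_table m n x"
  proof
    assume "(a, c, j) \<in> seq_table m n x"
    then obtain b where b: "a \<le> b" "b < c" "x c + m * (c - 1 - b) + j \<le> x b"
      by (auto simp: seq_table_def)
    show False
    proof (cases "a = b")
      case False
      have "c - 1 - a = (c - 1 - b) + (b - a)"
        using b by simp
      then have "m * (c - 1 - a) = m * (c - 1 - b) + m * (b - a)"
        by (metis distrib_left)
      then show ?thesis
        using between[of b] b False j by simp
    qed (use b a j in simp)
  qed
  ultimately show ?thesis by blast
qed

lemma seq_table_inj:
  assumes x: "ballot_seq m n x" and y: "ballot_seq m n y" and eq: "seq_table m n x = seq_table m n y"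
  shows "1 \<le> a \<Longrightarrow> a \<le> n \<Longrightarrow> x a = y a"
proof (induction "n - a" arbitrary: a rule: less_induct)
  case less
  then have "x b = y b" if "a < b" "b \<le> n" for b
    using that by simp
  then show ?case
    using seq_table_separates[OF x y, of a] seq_table_separates[OF y x, of a] eq less.prems
    by (metis linorder_neqE_nat)
qed

text \<open>The table of \<open>x\<close> is also the table of its own row sizes, so injectivity
  identifies the two sequences without computing any cardinality.\<close>

lemma row_seq_table:
  assumes "ballot_seq m n x" "1 \<le> a" "a \<le> n"
  shows "card (row (seq_table m n x) a) = x a"
  using seq_table_inj[OF ballot_seq_row[OF seq_table_in_dec_tables] assms(1)] assms(2,3)
    seq_table_row[OF seq_table_in_dec_tables] by metis

text \<open>The peak \<open>(f, j)\<close> names the East step immediately before the North step labelled \<open>c\<close>, and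
  \<open>drop_block\<close> collects the North steps of the factor exchanged with it by the rotation.\<close>

definition peak :: "(nat \<times> nat \<times> nat) set \<Rightarrow> nat \<Rightarrow> nat \<Rightarrow> nat \<Rightarrow> bool" where
  "peak X c f j \<longleftrightarrow> (c, f, j) \<in> X \<and> (Suc c, f, j) \<notin> X \<and>
     (\<forall>g i. (c, g, i) \<in> X \<longrightarrow> (Suc c, g, i) \<notin> X \<longrightarrow> g < f \<or> g = f \<and> i \<le> j)"

definition drop_block :: "nat \<Rightarrow> (nat \<times> nat \<times> nat) set \<Rightarrow> nat \<Rightarrow> nat set" where
  "drop_block m X c = {b. 1 \<le> b \<and> b \<le> c \<and> (b = c \<or> (b, c, m) \<notin> X)}"

definition drop_peak :: "nat \<Rightarrow> (nat \<times> nat \<times> nat) set \<Rightarrow> nat \<Rightarrow> nat \<Rightarrow> nat \<Rightarrow> (nat \<times> nat \<times> nat) set" where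
  "drop_peak m X c f j = X - drop_block m X c \<times> {(f, j)}"

lemma peak_exists:
  assumes X: "X \<in> tables m n" and "(c, g, i) \<in> X" "(Suc c, g, i) \<notin> X"
  obtains f j where "peak X c f j"
proof -
  let ?E = "row X c - row X (Suc c)"
  have fin: "finite ?E" "?E \<noteq> {}"
    using finite_row[OF X] assms by (auto simp: row_def)
  define f where "f = Max (fst ` ?E)"
  have f: "f \<in> fst ` ?E" "\<And>g i. (g, i) \<in> ?E \<Longrightarrow> g \<le> f"
    unfolding f_def using fin by (auto intro!: Max_in Max_ge) (force intro: Max_ge)
  let ?J = "{j. (f, j) \<in> ?E}"
  have "?J \<subseteq> snd ` ?E" by force
  then have J: "finite ?J" "?J \<noteq> {}"
    using fin(1) f(1) finite_subset[of ?J "snd ` ?E"] by auto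
  then have "Max ?J \<in> ?J" "\<And>j. j \<in> ?J \<Longrightarrow> j \<le> Max ?J"
    using Max_in[of ?J] Max_ge[of ?J] by blast+
  then have "peak X c f (Max ?J)"
    using f(2) unfolding peak_def row_def by (force simp: le_less)
  then show ?thesis by (rule that)
qed

text \<open>An entry beyond column \<open>c\<close> in a dropped row is inherited by row
  \<open>c\<close> (\<open>to_c\<close>), and a row that is not dropped is full in the columns of
  all dropped rows after it (\<open>D_down\<close>). Together with maximality of the peak this shows
  that the remaining entries never require a removed one.\<close>

lemma drop_peak_in_dec_tables:
  assumes X: "X \<in> dec_tables m n" and pk: "peak X c f j"
  shows "drop_peak m X c f j \<in> dec_tables m n"
proof -
  note XT = dec_tablesD[OF X]
  have cf: "(c, f, j) \<in> X" "(Suc c, f, j) \<notin> X"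
    and top: "\<And>g i. (c, g, i) \<in> X \<Longrightarrow> (Suc c, g, i) \<notin> X \<Longrightarrow> g < f \<or> g = f \<and> i \<le> j"
    using pk by (auto simp: peak_def)
  note r = tables_range[OF XT cf(1)]
  let ?D = "drop_block m X c"
  let ?Y = "drop_peak m X c f j"
  have Y: "(a, g, i) \<in> ?Y \<longleftrightarrow> (a, g, i) \<in> X \<and> \<not> (a \<in> ?D \<and> g = f \<and> i = j)" for a g i
    by (auto simp: drop_peak_def)
  have D_le: "b \<le> c" "1 \<le> b" if "b \<in> ?D" for b
    using that by (auto simp: drop_block_def)
  have to_c: "(c, g, i) \<in> X" if "b \<in> ?D" "(b, g, i) \<in> X" "c < g" for b g i
    using that tables_cotrans[OF XT that(2), of c] by (cases "b = c") (auto simp: drop_block_def)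
  have D_down: "(a, b, m) \<in> X" if "a \<notin> ?D" "b \<in> ?D" "1 \<le> a" "a < b" for a b
  proof -
    have "(a, c, m) \<in> X"
      using that D_le[OF that(2)] by (auto simp: drop_block_def)
    then show ?thesis
      using that D_le[OF that(2)] tables_cotrans[OF XT, of a c m b]
      by (cases "b = c") (auto simp: drop_block_def)
  qed
  have dec: "(a, g, i) \<in> ?Y" if "(b, g, i) \<in> ?Y" "1 \<le> a" "a < b" for a b g i
  proof -
    have b: "(b, g, i) \<in> X" "\<not> (b \<in> ?D \<and> g = f \<and> i = j)"
      using that by (auto simp: Y)
    then have "(a, g, i) \<in> X"
      using dec_tables_dec[OF X] that by auto
    moreover have "\<not> (a \<in> ?D \<and> g = f \<and> i = j)"
    proof
      assume *: "a \<in> ?D \<and> g = f \<and> i = j"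
      then have "b \<notin> ?D" using b by simp
      have "b \<le> c"
        using dec_tables_dec[OF X, of b f j "Suc c"] b * cf by force
      then have "(b, c, m) \<in> X"
        using \<open>b \<notin> ?D\<close> that by (auto simp: drop_block_def)
      then have "(a, c, m) \<in> X"
        using dec_tables_dec[OF X] that by auto
      then show False
        using * \<open>b \<le> c\<close> that by (auto simp: drop_block_def)
    qed
    ultimately show ?thesis by (simp add: Y)
  qed
  have "?Y \<in> tables m n"
  proof (rule tablesI)
    show "?Y \<subseteq> triples m n"
      using tables_triples[OF XT] by (auto simp: drop_peak_def)
    show "(a, g, k) \<in> ?Y" if h: "(a, g, i) \<in> ?Y" "1 \<le> k" "k \<le> i" for a g i k
    proof -
      have "(a, g, k) \<in> X"
        using h tables_down[OF XT] by (auto simp: Y)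
      moreover have "\<not> (a \<in> ?D \<and> g = f \<and> k = j)"
      proof
        assume *: "a \<in> ?D \<and> g = f \<and> k = j"
        then have "i \<noteq> j" using h by (auto simp: Y)
        then have "j < i" using h * by simp
        \<comment> \<open>A higher rank would pass to row \<open>c\<close> and, the peak being
          maximal, also lie in row \<open>Suc c\<close>, forcing the peak itself into that
          row.\<close>
        have "(c, f, i) \<in> X"
          using to_c[of a f i] * h r by (auto simp: Y)
        then have "(Suc c, f, i) \<in> X"
          using top[of f i] \<open>j < i\<close> by auto
        then show False
          using tables_down[OF XT, of "Suc c" f i j] \<open>j < i\<close> cf r by auto
      qed
      ultimately show ?thesis by (simp add: Y)
    qed
    show "(a, g, i) \<in> ?Y" if h: "(a, b, k) \<in> ?Y" "(b, g, i) \<in> ?Y" for a b g i k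
      using dec[OF h(2), of a] tables_range[OF XT, of a b k] h(1) by (auto simp: Y)
    show "(b, g, i) \<in> ?Y \<or> (a, b, m) \<in> ?Y" if h: "(a, g, i) \<in> ?Y" "a < b" "b < g" for a b g i
    proof -
      have ag: "(a, g, i) \<in> X" "\<not> (a \<in> ?D \<and> g = f \<and> i = j)"
        using h by (auto simp: Y)
      note r' = tables_range[OF XT ag(1)]
      consider (left) "(b, g, i) \<in> X" "(b, g, i) \<notin> ?Y" | (right) "(a, b, m) \<in> X" "(a, b, m) \<notin> ?Y"
        | "(b, g, i) \<in> ?Y \<or> (a, b, m) \<in> ?Y"
        using tables_cotrans[OF XT ag(1) h(2,3)] by blast
      then show ?thesis
      proof cases
        \<comment> \<open>The removed alternative lies in a dropped row but \<open>a\<close> is not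
          dropped, so \<open>(a, b, m)\<close> is available and untouched.\<close>
        case left
        then have *: "b \<in> ?D" "g = f" "i = j" by (auto simp: Y)
        then have "a \<notin> ?D" using ag by simp
        then have "(a, b, m) \<in> X"
          using D_down[of a b] * h r' by simp
        then show ?thesis
          using \<open>a \<notin> ?D\<close> by (simp add: Y)
      next
        \<comment> \<open>Here \<open>(a, f, m)\<close> is removed, so the peak has rank
          \<open>m\<close>. The entry in column \<open>g > f\<close> passes to row \<open>c\<close>
          and by maximality to row \<open>Suc c\<close>. Unless \<open>f\<close> is that row,
          splitting at \<open>f\<close> gives \<open>(f, g, i)\<close>, since
          \<open>(Suc c, f, m)\<close> is absent.\<close>
        case right
        then have *: "a \<in> ?D" "b = f" "m = j" by (auto simp: Y)
        have "(c, g, i) \<in> X"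
          using to_c[of a g i] * ag h r by auto
        then have **: "(Suc c, g, i) \<in> X"
          using top[of g i] * h by auto
        have "(f, g, i) \<in> X"
        proof (cases "f = Suc c")
          case False
          then show ?thesis
            using tables_cotrans[OF XT **, of f] cf * h r by auto
        qed (use ** in simp)
        then have "(b, g, i) \<in> ?Y"
          unfolding Y using *(2) h(3) by simp
        then show ?thesis ..
      qed
    qed
  qed
  then show ?thesis
    using dec unfolding dec_tables_def by blast
qed

lemma row_drop_peak:
  assumes X: "X \<in> dec_tables m n" and pk: "peak X c f j"
  shows "card (row (drop_peak m X c f j) b) = card (row X b) - (if b \<in> drop_block m X c then 1 else 0)"
proof (cases "b \<in> drop_block m X c")
  case True
  then have "(b, f, j) \<in> X"
    using dec_tables_dec[OF X, of c f j b] pk by (auto simp: peak_def drop_block_def)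
  then have "row (drop_peak m X c f j) b = row X b - {(f, j)}" "(f, j) \<in> row X b"
    using True by (auto simp: row_def drop_peak_def)
  then show ?thesis
    using True by simp
next
  case False
  then have "row (drop_peak m X c f j) b = row X b"
    by (auto simp: row_def drop_peak_def)
  then show ?thesis using False by simp
qed

text \<open>Take the last row \<open>c\<close> in which the tables differ. An entry missing there is
  not in row \<open>Suc c\<close> of \<open>X\<close>, so \<open>X\<close> has a peak at
  \<open>c\<close>. If \<open>Y\<close> contained the peak, downward closure or cotransitivity at
  the missing column would give a contradiction. By cotransitivity at \<open>c\<close>,
  \<open>Y\<close> then misses it in all dropped rows.\<close>

lemma drop_peak_below:
  assumes X: "X \<in> dec_tables m n" and Y: "Y \<in> dec_tables m n" and "Y \<subset> X"
  obtains c f j where "peak X c f j" "Y \<subseteq> drop_peak m X c f j"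
proof -
  note XT = dec_tablesD[OF X] and YT = dec_tablesD[OF Y]
  have fin: "finite (fst ` (X - Y))" "fst ` (X - Y) \<noteq> {}"
    using finite_tables[OF XT] assms(3) by auto
  define c where "c = Max (fst ` (X - Y))"
  have c: "c \<in> fst ` (X - Y)" "\<And>a g i. (a, g, i) \<in> X - Y \<Longrightarrow> a \<le> c"
    unfolding c_def using fin by (auto intro!: Max_in) (force intro: Max_ge)
  then obtain f0 j0 where 0: "(c, f0, j0) \<in> X" "(c, f0, j0) \<notin> Y" by auto
  note r0 = tables_range[OF XT 0(1)]
  have 1: "(Suc c, f0, j0) \<notin> X"
    using c(2)[of "Suc c" f0 j0] dec_tables_dec[OF Y, of "Suc c" f0 j0 c] 0 r0 by auto
  obtain f j where pk: "peak X c f j"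
    using peak_exists[OF XT 0(1) 1] .
  then have fj: "(c, f, j) \<in> X" "(Suc c, f, j) \<notin> X" "f0 < f \<or> f0 = f \<and> j0 \<le> j"
    using 0 1 by (auto simp: peak_def)
  note r = tables_range[OF XT fj(1)]
  have "(c, f, j) \<notin> Y"
  proof
    assume cY: "(c, f, j) \<in> Y"
    show False
    proof (cases "f0 = f")
      case True
      then show ?thesis
        using tables_down[OF YT cY, of j0] 0 fj r0 by auto
    next
      case False
      then have "(f0, f, j) \<in> Y \<or> (c, f0, m) \<in> Y"
        using tables_cotrans[OF YT cY, of f0] fj r0 by auto
      moreover have "(c, f0, m) \<notin> Y"
        using tables_down[OF YT, of c f0 m j0] 0 r0 by auto
      ultimately have "(f0, f, j) \<in> X"
        using assms(3) by auto
      then show ?thesis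
        using dec_tables_dec[OF X, of f0 f j "Suc c"] fj r0 by auto
    qed
  qed
  then have "(b, f, j) \<notin> Y" if "b \<in> drop_block m X c" for b
    using that tables_cotrans[OF YT, of b f j c] assms(3) r
    by (cases "b = c") (auto simp: drop_block_def)
  then have "Y \<subseteq> drop_peak m X c f j"
    using assms(3) by (auto simp: drop_peak_def)
  with pk show ?thesis by (rule that)
qed


section \<open>Ballot paths as lists of East counts\<close>

fun easts :: "nat \<Rightarrow> step list \<Rightarrow> nat list" where
  "easts k [] = []"
| "easts k (East # w) = easts (Suc k) w"
| "easts k (North # w) = k # easts k w"

lemma length_easts [simp]: "length (easts k w) = count_list w North"
  by (induction k w rule: easts.induct) auto

lemma easts_append: "easts k (u @ v) = easts k u @ easts (k + count_list u East) v"
  by (induction k u rule: easts.induct) auto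

lemma easts_Suc: "easts (Suc k) w = map Suc (easts k w)"
  by (induction k w rule: easts.induct) auto

lemma easts_ge: "e \<in> set (easts k w) \<Longrightarrow> k \<le> e"
  by (induction k w rule: easts.induct) auto

lemma easts_le: "e \<in> set (easts k w) \<Longrightarrow> e \<le> k + count_list w East"
  by (induction k w rule: easts.induct) auto

lemma sorted_easts: "sorted (easts k w)"
  by (induction k w rule: easts.induct) (auto dest: easts_ge)

lemma split_at_North:
  assumes "p < count_list w North"
  obtains u v where "w = u @ North # v" "count_list u North = p" "easts k w ! p = k + count_list u East"
proof -
  have "\<exists>u v. w = u @ North # v \<and> count_list u North = p \<and> easts k w ! p = k + count_list u East"
    using assms
  proof (induction k w arbitrary: p rule: easts.induct)
    case (2 k w)
    then obtain u v where "w = u @ North # v" "count_list u North = p"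
      "easts (Suc k) w ! p = Suc k + count_list u East" by force
    then show ?case
      by (intro exI[of _ "East # u"] exI[of _ v]) simp
  next
    case (3 k w)
    show ?case
    proof (cases p)
      case 0
      then show ?thesis by (intro exI[of _ "[]"] exI[of _ w]) simp
    next
      case (Suc p')
      then obtain u v where "w = u @ North # v" "count_list u North = p'"
        "easts k w ! p' = k + count_list u East" using 3 by force
      then show ?thesis
        using Suc by (intro exI[of _ "North # u"] exI[of _ v]) simp
    qed
  qed simp
  then show ?thesis using that by blast
qed

text \<open>The total number of East steps fixes those after the last North step, which the list
  does not record.\<close>

lemma easts_inj: "easts k w = easts k w' \<Longrightarrow> count_list w East = count_list w' East \<Longrightarrow> w = w'"
proof (induction k w arbitrary: w' rule: easts.induct)
  case (1 k)
  then show ?case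
    by (cases "(k, w')" rule: easts.cases) (auto dest: arg_cong[where f = length])
next
  case (2 k w)
  show ?case
  proof (cases "(k, w')" rule: easts.cases)
    case (3 k' v)
    then have "k \<in> set (easts (Suc k) w)"
      using 2 by simp
    then show ?thesis
      using easts_ge by fastforce
  qed (use 2 in auto)
next
  case (3 k w)
  show ?case
  proof (cases "(k, w')" rule: easts.cases)
    case (2 k' v)
    then have "k \<in> set (easts (Suc k) v)"
      using 3 by (metis Pair_inject easts.simps(2,3) list.set_intros(1))
    then show ?thesis
      using easts_ge by fastforce
  qed (use 3 in auto)
qed

text \<open>Inverse of \<open>easts\<close>: \<open>t\<close> is the total number of East steps and
  \<open>k\<close> the number already placed.\<close>

fun path_of :: "nat \<Rightarrow> nat \<Rightarrow> nat list \<Rightarrow> step list" where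
  "path_of t k [] = replicate (t - k) East"
| "path_of t k (e # es) = replicate (e - k) East @ North # path_of t e es"

lemma count_list_replicate: "count_list (replicate i x) y = (if x = y then i else 0)"
  by (induction i) auto

lemma easts_replicate: "easts k (replicate i East @ w) = easts (k + i) w"
  by (induction i arbitrary: k) auto

lemma path_of:
  assumes "sorted es" "\<forall>e\<in>set es. k \<le> e \<and> e \<le> t" "k \<le> t"
  shows "easts k (path_of t k es) = es" "count_list (path_of t k es) East = t - k"
    "count_list (path_of t k es) North = length es"
  using assms
proof (induction es arbitrary: k)
  case Nil
  {
    case 1
    then show ?case
      using easts_replicate[of k "t - k" "[]"] by simp
  next
    case 2
    then show ?case by (simp add: count_list_replicate)
  next
    case 3
    then show ?case by (simp add: count_list_replicate)
  }
next
  case (Cons e es)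
  {
    case 1
    then show ?case using Cons by (simp add: easts_replicate)
  next
    case 2
    then show ?case using Cons by (simp add: count_list_replicate)
  next
    case 3
    then show ?case using Cons by (simp add: count_list_replicate)
  }
qed

text \<open>It suffices to test just before North steps, where the East count is largest for the
  given height; after the last North step the total \<open>n * m\<close> gives the bound.\<close>

lemma ballot_path_iff:
  "ballot_path m n w \<longleftrightarrow> count_list w North = n \<and> count_list w East = n * m \<and>
     (\<forall>p<n. easts 0 w ! p \<le> m * p)"
proof (intro iffI conjI allI impI)
  fix p assume w: "ballot_path m n w" and p: "p < n"
  then obtain u v where u: "w = u @ North # v" "count_list u North = p" "easts 0 w ! p = 0 + count_list u East"
    using split_at_North[of p w 0] by (auto simp: ballot_path_def)
  then have "prefix u w" by simp
  then show "easts 0 w ! p \<le> m * p"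
    using w u unfolding ballot_path_def by auto
next
  assume w: "count_list w North = n \<and> count_list w East = n * m \<and> (\<forall>p<n. easts 0 w ! p \<le> m * p)"
  have "count_list u East \<le> m * count_list u North" if pre: "prefix u w" for u
  proof -
    obtain v where v: "w = u @ v"
      using pre by (auto simp: prefix_def)
    show ?thesis
    proof (cases "count_list u North = n")
      case True
      then show ?thesis using w v by (auto simp: mult.commute)
    next
      case False
      then have "count_list v North > 0"
        using w v by auto
      then have "easts (count_list u East) v ! 0 \<in> set (easts (count_list u East) v)"
        by simp
      then have "count_list u East \<le> easts (count_list u East) v ! 0"
        by (rule easts_ge)
      also have "\<dots> = easts 0 w ! count_list u North"
        using v by (simp add: easts_append nth_append)
      also have "\<dots> \<le> m * count_list u North"
        using w v \<open>count_list v North > 0\<close> by auto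
      finally show ?thesis .
    qed
  qed
  then show "ballot_path m n w"
    using w by (auto simp: ballot_path_def)
qed (auto simp: ballot_path_def)

text \<open>Row \<open>a\<close> of a table corresponds to the \<open>(n + 1 - a)\<close>-th North step, that is, to index
  \<open>n - a\<close> of the list of its East counts.\<close>

definition path_seq :: "nat \<Rightarrow> step list \<Rightarrow> nat \<Rightarrow> nat" where
  "path_seq n w a = easts 0 w ! (n - a)"

lemma ballot_seq_path_seq:
  assumes "ballot_path m n w"
  shows "ballot_seq m n (path_seq n w)"
  unfolding ballot_seq_def path_seq_def
proof (intro conjI ballI allI impI)
  show "easts 0 w ! (n - a) \<le> m * (n - a)" if "a \<in> {1..n}" for a
    using assms that by (auto simp: ballot_path_iff)
  show "easts 0 w ! (n - Suc a) \<le> easts 0 w ! (n - a)" if "1 \<le> a" "a < n" for a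
    using assms that sorted_easts[of 0 w] by (intro sorted_nth_mono) (auto simp: ballot_path_iff)
qed

lemma path_seq_surj:
  assumes x: "ballot_seq m n x"
  shows "\<exists>w. ballot_path m n w \<and> (\<forall>a. 1 \<le> a \<longrightarrow> a \<le> n \<longrightarrow> path_seq n w a = x a)"
proof -
  define es where "es = map (\<lambda>p. x (n - p)) [0..<n]"
  have step: "x (n - p) \<le> x (n - Suc p)" if "Suc p < n" for p
    using x[unfolded ballot_seq_def, THEN conjunct2, rule_format, of "n - Suc p"] that
    by (simp add: Suc_diff_Suc)
  have "sorted es"
    unfolding sorted_iff_nth_Suc es_def using step by simp
  moreover have bound: "es ! p \<le> m * p" if "p < n" for p
    using x[unfolded ballot_seq_def, THEN conjunct1, rule_format, of "n - p"] that
    by (simp add: es_def)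
  moreover have "\<forall>e\<in>set es. 0 \<le> e \<and> e \<le> n * m"
  proof
    fix e assume "e \<in> set es"
    then obtain p where "p < n" "e = es ! p"
      by (auto simp: in_set_conv_nth es_def)
    then have "e \<le> m * p" using bound by simp
    also have "\<dots> \<le> n * m" using \<open>p < n\<close> by (simp add: mult.commute)
    finally show "0 \<le> e \<and> e \<le> n * m" by simp
  qed
  ultimately have w: "easts 0 (path_of (n * m) 0 es) = es"
    "count_list (path_of (n * m) 0 es) East = n * m"
    "count_list (path_of (n * m) 0 es) North = n"
    using path_of[of es 0 "n * m"] by (auto simp: es_def)
  show ?thesis
  proof (intro exI conjI allI impI)
    show "ballot_path m n (path_of (n * m) 0 es)"
      using w bound by (simp add: ballot_path_iff)
    show "path_seq n (path_of (n * m) 0 es) a = x a" if "1 \<le> a" "a \<le> n" for a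
      using that w by (simp add: path_seq_def es_def)
  qed
qed

lemma path_seq_inj:
  assumes "ballot_path m n w" "ballot_path m n w'"
    and eq: "\<And>a. 1 \<le> a \<Longrightarrow> a \<le> n \<Longrightarrow> path_seq n w a = path_seq n w' a"
  shows "w = w'"
proof (rule easts_inj)
  show "easts 0 w = easts 0 w'"
  proof (rule nth_equalityI)
    show "length (easts 0 w) = length (easts 0 w')"
      using assms by (simp add: ballot_path_iff)
    show "easts 0 w ! p = easts 0 w' ! p" if "p < length (easts 0 w)" for p
      using that eq[of "n - p"] assms(1) by (simp add: path_seq_def ballot_path_iff)
  qed
  show "count_list w East = count_list w' East"
    using assms by (simp add: ballot_path_iff)
qed


section \<open>Rotations in terms of East counts and of tables\<close>

lemma rotation_path_seq:
  assumes m: "1 \<le> m" and w: "ballot_path m n w" "w = u @ [East] @ P @ v"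
    and P: "P \<noteq> []" "ballot_path m k P"
      "\<And>Q j. strict_prefix Q P \<Longrightarrow> Q \<noteq> [] \<Longrightarrow> \<not> ballot_path m j Q"
  defines "c \<equiv> n - count_list u North" and "w' \<equiv> u @ P @ [East] @ v"
  shows "1 \<le> c" "c < n" "path_seq n w (Suc c) < path_seq n w c" "ballot_path m n w'"
    "\<And>b. 1 \<le> b \<Longrightarrow> b \<le> n \<Longrightarrow> path_seq n w' b =
       path_seq n w b - (if b \<in> drop_block m (seq_table m n (path_seq n w)) c then 1 else 0)"
proof -
  let ?p = "count_list u North" and ?e = "count_list u East" and ?X = "easts 0 w" and ?X' = "easts 0 w'"
  have cP: "count_list P North = k" "count_list P East = k * m"
    and preP: "\<And>Q. prefix Q P \<Longrightarrow> count_list Q East \<le> m * count_list Q North"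
    using P(2) by (auto simp: ballot_path_def)
  obtain P' where P': "P = North # P'"
  proof (cases P)
    case (Cons s P'')
    then show ?thesis
      using that preP[of "[s]"] by (cases s) auto
  qed (use P in auto)
  then have "1 \<le> k" using cP by auto
  have cw: "count_list w North = n" "count_list w East = n * m"
    and prew: "\<And>Q. prefix Q w \<Longrightarrow> count_list Q East \<le> m * count_list Q North"
    using w(1) by (auto simp: ballot_path_def)
  have n: "n = ?p + k + count_list v North"
    using cw(1) cP by (simp add: w(2))
  have "Suc ?e \<le> m * ?p"
    using prew[of "u @ [East]"] by (simp add: w(2))
  then have "1 \<le> ?p" by (cases ?p) auto
  have nc: "n - c = ?p" using n by (simp add: c_def)
  show c: "1 \<le> c" "c < n"
    using n \<open>1 \<le> k\<close> \<open>1 \<le> ?p\<close> by (auto simp: c_def)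
  have X: "?X = easts 0 u @ map Suc (easts ?e P) @ easts (Suc ?e + k * m) v"
    using cP by (simp add: w(2) easts_append easts_Suc)
  have X': "?X' = easts 0 u @ easts ?e P @ easts (Suc ?e + k * m) v"
    using cP by (simp add: w'_def easts_append)
  have Xp: "?X ! ?p = Suc ?e"
    unfolding X P' by (simp add: nth_append)
  have "?X ! (?p - 1) \<in> set (easts 0 u)"
    unfolding X using \<open>1 \<le> ?p\<close> by (simp add: nth_append)
  then have "?X ! (?p - 1) \<le> ?e"
    using easts_le by fastforce
  moreover have "n - Suc c = ?p - 1"
    using nc by simp
  ultimately show "path_seq n w (Suc c) < path_seq n w c"
    using Xp nc \<open>n - Suc c = ?p - 1\<close> by (simp add: path_seq_def)
  \<comment> \<open>One East step moves behind \<open>P\<close>, so exactly the \<open>k\<close>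
    North steps of \<open>P\<close> lose one East step before them.\<close>
  have X'q: "?X' ! q = ?X ! q - (if ?p \<le> q \<and> q < ?p + k then 1 else 0)" for q
  proof -
    consider "q < ?p" | "?p \<le> q" "q < ?p + k" | "?p + k \<le> q" by linarith
    then show ?thesis
    proof cases
      case 2
      then have "q - ?p < k" by simp
      then show ?thesis
        unfolding X X' using 2 cP by (simp add: nth_append)
    next
      case 3
      then have "\<not> q - ?p < k" "\<not> q < ?p" by simp_all
      then show ?thesis
        unfolding X X' using 3 cP by (simp add: nth_append)
    qed (simp add: X X' nth_append)
  qed
  \<comment> \<open>As no proper nonempty prefix of \<open>P\<close> is a ballot path,
    \<open>P\<close> is strictly above its starting level before each of its later North
    steps.\<close>
  have inside: "?X ! q < Suc ?e + m * (q - ?p)" if q: "?p < q" "q < ?p + k" for q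
  proof -
    have "q - ?p < count_list P North"
      using q cP by simp
    then obtain P1 P2 where P12: "P = P1 @ North # P2" "count_list P1 North = q - ?p"
      "easts ?e P ! (q - ?p) = ?e + count_list P1 East"
      by (rule split_at_North)
    have le: "count_list P1 East \<le> m * (q - ?p)"
      using preP[of P1] P12 by simp
    have "count_list P1 East \<noteq> m * (q - ?p)"
    proof
      assume "count_list P1 East = m * (q - ?p)"
      then have "ballot_path m (q - ?p) P1"
        using preP P12 by (auto simp: ballot_path_def mult.commute)
      moreover have "strict_prefix P1 P" "P1 \<noteq> []"
        using P12 q by (auto simp: strict_prefix_def)
      ultimately show False using P(3) by blast
    qed
    moreover have "?X ! q = Suc (easts ?e P ! (q - ?p))"
    proof -
      have "\<not> q < ?p" "q - ?p < k"
        using q by simp_all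
      then show ?thesis
        unfolding X using cP by (simp add: nth_append)
    qed
    ultimately show ?thesis using le P12 by simp
  qed
  have outside: "Suc ?e + m * k \<le> ?X ! (?p + k)" if "?p + k < n"
  proof -
    have "?X ! (?p + k) \<in> set (easts (Suc ?e + k * m) v)"
      unfolding X using that n cP by (simp add: nth_append)
    then show ?thesis
      using easts_ge by (fastforce simp: mult.commute)
  qed
  \<comment> \<open>The last East step matched with \<open>c\<close> is the one closing
    \<open>P\<close>, and \<open>(b, c, m)\<close> asks whether it comes before the North step
    \<open>b\<close>. The test in \<open>drop_block\<close> thus singles out the North steps of
    \<open>P\<close>.\<close>
  have block: "b \<in> drop_block m (seq_table m n (path_seq n w)) c \<longleftrightarrow> ?p \<le> n - b \<and> n - b < ?p + k"
    if b: "1 \<le> b" "b \<le> n" for b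
  proof
    assume q: "?p \<le> n - b \<and> n - b < ?p + k"
    have "(b, c, m) \<notin> seq_table m n (path_seq n w)" if "b \<noteq> c"
    proof
      assume "(b, c, m) \<in> seq_table m n (path_seq n w)"
      then obtain d where d: "b \<le> d" "d < c"
        "path_seq n w c + m * (c - 1 - d) + m \<le> path_seq n w d"
        by (auto simp: seq_table_def)
      have "?X ! (n - d) < Suc ?e + m * (n - d - ?p)"
        by (rule inside) (use d q c nc b in auto)
      moreover have "n - d - ?p = c - 1 - d + 1"
        using d c nc by auto
      then have "m * (n - d - ?p) = m * (c - 1 - d) + m"
        by (simp only: distrib_left mult_1_right)
      ultimately show False
        using d Xp nc by (simp add: path_seq_def)
    qed
    then show "b \<in> drop_block m (seq_table m n (path_seq n w)) c"
      using b q nc c by (auto simp: drop_block_def)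
  next
    assume D: "b \<in> drop_block m (seq_table m n (path_seq n w)) c"
    then have "b \<le> c" by (simp add: drop_block_def)
    then have "?p \<le> n - b" using nc by auto
    moreover have "n - b < ?p + k"
    proof (rule ccontr)
      assume "\<not> n - b < ?p + k"
      then have b_le: "b + k \<le> c" using nc b c by auto
      then have "(b, c, m) \<notin> seq_table m n (path_seq n w)"
        using D \<open>1 \<le> k\<close> by (auto simp: drop_block_def)
      moreover have "n - (c - k) = ?p + k"
        using nc b_le c by simp
      \<comment> \<open>The first North step after \<open>P\<close> is labelled
        \<open>c - k\<close>; it serves as witness for \<open>(b, c, m)\<close>.\<close>
      then have "path_seq n w c + m * k \<le> path_seq n w (c - k)"
        unfolding path_seq_def nc using outside Xp b_le b nc by simp
      moreover have "m * k = m * (c - 1 - (c - k)) + m"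
        using b_le \<open>1 \<le> k\<close> b by (cases k) auto
      ultimately have "\<not> (c - k < c \<and> b \<le> c - k)"
        using b b_le c m unfolding seq_table_def triples_def by fastforce
      then show False
        using b_le \<open>1 \<le> k\<close> b by simp
    qed
    ultimately show "?p \<le> n - b \<and> n - b < ?p + k" ..
  qed
  show "path_seq n w' b =
      path_seq n w b - (if b \<in> drop_block m (seq_table m n (path_seq n w)) c then 1 else 0)"
    if "1 \<le> b" "b \<le> n" for b
    using block[OF that] X'q[of "n - b"] by (simp add: path_seq_def[of n w' b] path_seq_def[of n w b])
  have "\<forall>q<n. ?X' ! q \<le> m * q"
    using w(1) X'q unfolding ballot_path_iff by (simp add: le_diff_conv trans_le_add1)
  moreover have "count_list w' North = n" "count_list w' East = n * m"
    using cw unfolding w'_def w(2) by auto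
  ultimately show "ballot_path m n w'"
    by (simp add: ballot_path_iff)
qed

text \<open>A strict increase of East counts means that an East step immediately precedes the North
  step \<open>c\<close>. The factor \<open>P\<close> is the shortest nonempty prefix of the rest
  that returns to its starting level.\<close>

lemma rotation_exists:
  assumes m: "1 \<le> m" and w: "ballot_path m n w"
    and c: "1 \<le> c" "c < n" "path_seq n w (Suc c) < path_seq n w c"
  obtains u P v k where "w = u @ [East] @ P @ v" "P \<noteq> []" "ballot_path m k P"
    "\<And>Q j. strict_prefix Q P \<Longrightarrow> Q \<noteq> [] \<Longrightarrow> \<not> ballot_path m j Q" "count_list u North = n - c"
proof -
  have cw: "count_list w North = n" "count_list w East = n * m"
    and prew: "\<And>Q. prefix Q w \<Longrightarrow> count_list Q East \<le> m * count_list Q North"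
    using w by (auto simp: ballot_path_def)
  obtain U V where U: "w = U @ North # V" "count_list U North = n - c" "easts 0 w ! (n - c) = 0 + count_list U East"
    using split_at_North[of "n - c" w 0] c cw by auto
  obtain u where u: "U = u @ [East]"
  proof (cases U rule: rev_cases)
    case (snoc u s)
    show ?thesis
    proof (cases s)
      case North
      then have "count_list u North = n - Suc c"
        using U(2) snoc c by simp
      then have "path_seq n w (Suc c) = path_seq n w c"
        using U snoc North by (simp add: path_seq_def easts_append nth_append)
      then show ?thesis using c by simp
    qed (use snoc that in simp)
  qed (use U c in simp)
  define R where "R = North # V"
  have w_R: "w = u @ [East] @ R"
    using U u by (simp add: R_def)
  define good where "good l \<longleftrightarrow> 1 \<le> l \<and> l \<le> length R \<and>
    m * count_list (take l R) North \<le> count_list (take l R) East" for l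
  \<comment> \<open>The whole rest \<open>R\<close> qualifies, because the path is weakly above the
    line before \<open>R\<close> and ends on it.\<close>
  have "count_list (u @ [East]) East \<le> m * count_list (u @ [East]) North"
    using w_R by (intro prew) (simp add: prefix_def)
  moreover have "m * n = m * count_list u North + m * count_list R North"
    using cw(1) by (simp add: w_R flip: distrib_left)
  moreover have "count_list u East + 1 + count_list R East = m * n"
    using cw(2) by (simp add: w_R mult.commute)
  ultimately have "m * count_list R North \<le> count_list R East"
    by simp
  then have "good (length R)"
    by (simp add: good_def R_def)
  define l where "l = (LEAST l. good l)"
  have l: "good l" "\<And>l'. l' < l \<Longrightarrow> \<not> good l'"
    unfolding l_def using LeastI[of good] not_less_Least[of _ good] \<open>good (length R)\<close> by blast+
  define P where "P = take l R"
  have len: "1 \<le> l" "l \<le> length R" "length P = l"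
    using l(1) by (auto simp: good_def P_def)
  have short: "count_list Q East < m * count_list Q North" if Q: "strict_prefix Q P" "Q \<noteq> []" for Q
  proof -
    obtain S where S: "P = Q @ S" "S \<noteq> []"
      using Q by (auto simp: strict_prefix_def prefix_def)
    then have "length Q < l"
      using len by auto
    moreover have "Q = take (length Q) P"
      using S by simp
    ultimately have "length Q < l" "Q = take (length Q) R"
      by (simp_all add: P_def min_def)
    then show ?thesis
      using l(2)[of "length Q"] Q len by (cases Q) (auto simp: good_def not_le)
  qed
  have ge: "m * count_list P North \<le> count_list P East"
    using l(1) by (simp add: good_def P_def)
  have "P \<noteq> []" using len by auto
  then obtain P0 s where P0: "P = P0 @ [s]"
    by (cases P rule: rev_cases) auto
  have "hd P = North"
    using len by (simp add: P_def R_def hd_take)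
  \<comment> \<open>An East step lowers the level by only one, so the first return hits the starting
    level exactly.\<close>
  have eq: "count_list P East = m * count_list P North"
  proof (cases "P0 = []")
    case True
    then show ?thesis
      using ge \<open>hd P = North\<close> m P0 by simp
  next
    case False
    then have "count_list P0 East < m * count_list P0 North"
      using short P0 by (auto simp: strict_prefix_def)
    then show ?thesis
      using ge P0 by (cases s) auto
  qed
  show ?thesis
  proof (rule that)
    show "w = u @ [East] @ P @ drop l R"
      using w_R by (simp add: P_def)
    show "P \<noteq> []" by fact
    have "count_list Q East \<le> m * count_list Q North" if "prefix Q P" for Q
      using short[of Q] that eq by (cases "Q = P \<or> Q = []") (auto simp: strict_prefix_def)
    then show "ballot_path m (count_list P North) P"
      using eq by (simp add: ballot_path_def mult.commute)
    show "\<not> ballot_path m j Q" if "strict_prefix Q P" "Q \<noteq> []" for Q j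
      using short[OF that] by (auto simp: ballot_path_def mult.commute)
    show "count_list u North = n - c"
      using U u by simp
  qed
qed

definition table_of_path :: "nat \<Rightarrow> nat \<Rightarrow> step list \<Rightarrow> (nat \<times> nat \<times> nat) set" where
  "table_of_path m n w = seq_table m n (path_seq n w)"

lemma table_of_path_in_dec_tables: "table_of_path m n w \<in> dec_tables m n"
  unfolding table_of_path_def by (rule seq_table_in_dec_tables)

lemma row_table_of_path:
  "ballot_path m n w \<Longrightarrow> 1 \<le> a \<Longrightarrow> a \<le> n \<Longrightarrow> card (row (table_of_path m n w) a) = path_seq n w a"
  unfolding table_of_path_def by (rule row_seq_table[OF ballot_seq_path_seq])

text \<open>Both tables are decreasing and have equal row sizes, which determine them; individual
  East steps never have to be traced through the rotation.\<close>

lemma table_of_path_rotate: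
  assumes w: "ballot_path m n w" and c: "1 \<le> c" "c < n" and pk: "peak (table_of_path m n w) c f j"
    and w': "\<And>b. 1 \<le> b \<Longrightarrow> b \<le> n \<Longrightarrow> path_seq n w' b =
       path_seq n w b - (if b \<in> drop_block m (table_of_path m n w) c then 1 else 0)"
  shows "table_of_path m n w' = drop_peak m (table_of_path m n w) c f j"
proof -
  note X = table_of_path_in_dec_tables[of m n w]
  let ?Y = "drop_peak m (table_of_path m n w) c f j"
  have "path_seq n w' b = card (row ?Y b)" if "1 \<le> b" "b \<le> n" for b
    using row_drop_peak[OF X pk] w'[OF that] row_table_of_path[OF w that] by simp
  then have "table_of_path m n w' = seq_table m n (\<lambda>b. card (row ?Y b))"
    unfolding table_of_path_def[of m n w'] by (rule seq_table_cong)
  also have "\<dots> = ?Y"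
    by (rule seq_table_row[OF drop_peak_in_dec_tables[OF X pk]])
  finally show ?thesis .
qed

lemma rotation_table:
  assumes m: "1 \<le> m" and w: "ballot_path m n w" and rot: "rotation m w w'"
  shows "ballot_path m n w'" "table_of_path m n w' \<subseteq> table_of_path m n w"
proof -
  from rot show "ballot_path m n w'"
    by cases (use rotation_path_seq(4)[OF m w] in auto)
  from rot show "table_of_path m n w' \<subseteq> table_of_path m n w"
  proof cases
    case (1 P k u v)
    let ?X = "table_of_path m n w" and ?c = "n - count_list u North"
    note rot = rotation_path_seq[OF m w 1(1,3-5)]
    have "card (row ?X (Suc ?c)) < card (row ?X ?c)"
      using rot(1-3) row_table_of_path[OF w] by simp
    then have "\<not> row ?X ?c \<subseteq> row ?X (Suc ?c)"
      using finite_row[OF dec_tablesD[OF table_of_path_in_dec_tables]] card_mono by (metis not_le)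
    then obtain g i where "(?c, g, i) \<in> ?X" "(Suc ?c, g, i) \<notin> ?X"
      by (auto simp: row_def)
    then obtain f j where pk: "peak ?X ?c f j"
      using peak_exists[OF dec_tablesD[OF table_of_path_in_dec_tables]] by metis
    have "table_of_path m n w' = drop_peak m ?X ?c f j"
      using table_of_path_rotate[OF w rot(1,2) pk] rot(5) 1(2) unfolding table_of_path_def by blast
    then show ?thesis by (auto simp: drop_peak_def)
  qed
qed

lemma rotation_from_peak:
  assumes m: "1 \<le> m" and w: "ballot_path m n w" and pk: "peak (table_of_path m n w) c f j"
  obtains w' where "rotation m w w'" "ballot_path m n w'"
    "table_of_path m n w' = drop_peak m (table_of_path m n w) c f j"
proof -
  let ?X = "table_of_path m n w"
  note X = table_of_path_in_dec_tables[of m n w] and XT = dec_tablesD[OF table_of_path_in_dec_tables[of m n w]]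
  have cf: "(c, f, j) \<in> ?X" "(Suc c, f, j) \<notin> ?X"
    using pk by (auto simp: peak_def)
  note r = tables_range[OF XT cf(1)]
  then have c: "1 \<le> c" "c < n" by auto
  have "row ?X (Suc c) \<subset> row ?X c"
  proof
    show "row ?X (Suc c) \<subseteq> row ?X c"
      using dec_tables_dec[OF X _ c(1)] by (auto simp: row_def)
    show "row ?X (Suc c) \<noteq> row ?X c"
      using cf by (auto simp: row_def)
  qed
  then have "path_seq n w (Suc c) < path_seq n w c"
    using psubset_card_mono[OF finite_row[OF XT]] row_table_of_path[OF w] c by (metis Suc_leI le_SucI less_imp_le)
  then obtain u P v k where P: "w = u @ [East] @ P @ v" "P \<noteq> []" "ballot_path m k P"
    "\<And>Q j. strict_prefix Q P \<Longrightarrow> Q \<noteq> [] \<Longrightarrow> \<not> ballot_path m j Q" "count_list u North = n - c"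
    using rotation_exists[OF m w c] by blast
  let ?w' = "u @ P @ [East] @ v"
  have "n - count_list u North = c" using P(5) c by simp
  note rot = rotation_path_seq[OF m w P(1-4), unfolded this]
  show ?thesis
  proof (rule that)
    show "rotation m w ?w'"
      unfolding P(1) by (rule rotation.intros[OF P(2-4)])
    show "ballot_path m n ?w'" by (rule rot(4))
    show "table_of_path m n ?w' = drop_peak m ?X c f j"
      using table_of_path_rotate[OF w c pk] rot(5) unfolding table_of_path_def by blast
  qed
qed

lemma rotations_iff:
  assumes m: "1 \<le> m" and w: "ballot_path m n w" and w': "ballot_path m n w'"
  shows "(rotation m)\<^sup>*\<^sup>* w w' \<longleftrightarrow> table_of_path m n w' \<subseteq> table_of_path m n w"
proof
  assume "(rotation m)\<^sup>*\<^sup>* w w'"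
  then have "ballot_path m n w' \<and> table_of_path m n w' \<subseteq> table_of_path m n w"
    by induction (use w rotation_table[OF m] in blast)+
  then show "table_of_path m n w' \<subseteq> table_of_path m n w" ..
next
  assume "table_of_path m n w' \<subseteq> table_of_path m n w"
  then show "(rotation m)\<^sup>*\<^sup>* w w'"
    using w
  proof (induction "card (table_of_path m n w)" arbitrary: w rule: less_induct)
    case less
    let ?X = "table_of_path m n w" and ?Y = "table_of_path m n w'"
    note X = table_of_path_in_dec_tables
    show ?case
    proof (cases "?Y = ?X")
      case True
      then have "w' = w"
        using path_seq_inj[OF w' less.prems(2)] row_table_of_path w' less.prems(2) by metis
      then show ?thesis by simp
    next
      case False
      then obtain c f j where pk: "peak ?X c f j" "?Y \<subseteq> drop_peak m ?X c f j"
        using drop_peak_below[OF X X] less.prems(1) by blast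
      obtain v where v: "rotation m w v" "ballot_path m n v" "table_of_path m n v = drop_peak m ?X c f j"
        using rotation_from_peak[OF m less.prems(2) pk(1)] .
      have "(c, f, j) \<in> ?X"
        using pk by (simp add: peak_def)
      moreover from this have "c \<in> drop_block m ?X c"
        using tables_range[OF dec_tablesD[OF X]] by (auto simp: drop_block_def)
      ultimately have "drop_peak m ?X c f j \<subset> ?X"
        by (auto simp: drop_peak_def)
      then have "card (table_of_path m n v) < card ?X"
        using v(3) finite_tables[OF dec_tablesD[OF X]] psubset_card_mono by metis
      then have "(rotation m)\<^sup>*\<^sup>* v w'"
        using less.hyps v pk(2) by simp
      with v(1) show ?thesis by (rule converse_rtranclp_into_rtranclp)
    qed
  qed
qed

lemma bij_betw_table_of_path:
  "bij_betw (table_of_path m n) {w. ballot_path m n w} (dec_tables m n)"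
  unfolding bij_betw_def
proof
  show "inj_on (table_of_path m n) {w. ballot_path m n w}"
  proof (rule inj_onI)
    fix w w' assume "w \<in> {w. ballot_path m n w}" "w' \<in> {w. ballot_path m n w}"
      "table_of_path m n w = table_of_path m n w'"
    then show "w = w'"
      using path_seq_inj[of m n w w'] row_table_of_path[of m n w] row_table_of_path[of m n w'] by simp
  qed
  show "table_of_path m n ` {w. ballot_path m n w} = dec_tables m n"
  proof
    show "dec_tables m n \<subseteq> table_of_path m n ` {w. ballot_path m n w}"
    proof
      fix X assume X: "X \<in> dec_tables m n"
      obtain w where w: "ballot_path m n w" "\<And>a. 1 \<le> a \<Longrightarrow> a \<le> n \<Longrightarrow> path_seq n w a = card (row X a)"
        using path_seq_surj[OF ballot_seq_row[OF X]] by blast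
      have "table_of_path m n w = X"
        unfolding table_of_path_def using seq_table_cong[of n "path_seq n w" "\<lambda>a. card (row X a)"] w(2)
          seq_table_row[OF X] by simp
      then show "X \<in> table_of_path m n ` {w. ballot_path m n w}"
        using w(1) by blast
    qed
  qed (use table_of_path_in_dec_tables in blast)
qed

section \<open>Retractions of lattices\<close>

lemma join_eqI:
  assumes "lattice L" "x \<in> carrier L" "y \<in> carrier L" "s \<in> carrier L" "x \<sqsubseteq>\<^bsub>L\<^esub> s" "y \<sqsubseteq>\<^bsub>L\<^esub> s"
    "\<And>z. z \<in> carrier L \<Longrightarrow> x \<sqsubseteq>\<^bsub>L\<^esub> z \<Longrightarrow> y \<sqsubseteq>\<^bsub>L\<^esub> z \<Longrightarrow> s \<sqsubseteq>\<^bsub>L\<^esub> z"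
  shows "x \<squnion>\<^bsub>L\<^esub> y = s"
proof -
  interpret lattice L by fact
  show ?thesis
    using assms join_left[of x y] join_right[of x y] join_le[of x s y] by (intro le_antisym) auto
qed

lemma meet_eqI:
  assumes "lattice L" "x \<in> carrier L" "y \<in> carrier L" "s \<in> carrier L" "s \<sqsubseteq>\<^bsub>L\<^esub> x" "s \<sqsubseteq>\<^bsub>L\<^esub> y"
    "\<And>z. z \<in> carrier L \<Longrightarrow> z \<sqsubseteq>\<^bsub>L\<^esub> x \<Longrightarrow> z \<sqsubseteq>\<^bsub>L\<^esub> y \<Longrightarrow> z \<sqsubseteq>\<^bsub>L\<^esub> s"
  shows "x \<sqinter>\<^bsub>L\<^esub> y = s"
proof -
  interpret lattice L by fact
  show ?thesis
    using assms meet_left[of x y] meet_right[of x y] meet_le[of s x y] by (intro le_antisym) auto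
qed

lemma latticeI:
  assumes eq: "eq L = (=)" and refl: "\<And>x. x \<in> carrier L \<Longrightarrow> x \<sqsubseteq>\<^bsub>L\<^esub> x"
    and antisym: "\<And>x y. x \<in> carrier L \<Longrightarrow> y \<in> carrier L \<Longrightarrow> x \<sqsubseteq>\<^bsub>L\<^esub> y \<Longrightarrow> y \<sqsubseteq>\<^bsub>L\<^esub> x \<Longrightarrow> x = y"
    and trans: "\<And>x y z. x \<in> carrier L \<Longrightarrow> y \<in> carrier L \<Longrightarrow> z \<in> carrier L \<Longrightarrow>
      x \<sqsubseteq>\<^bsub>L\<^esub> y \<Longrightarrow> y \<sqsubseteq>\<^bsub>L\<^esub> z \<Longrightarrow> x \<sqsubseteq>\<^bsub>L\<^esub> z"
    and join: "\<And>x y. x \<in> carrier L \<Longrightarrow> y \<in> carrier L \<Longrightarrow> \<exists>s\<in>carrier L. x \<sqsubseteq>\<^bsub>L\<^esub> s \<and> y \<sqsubseteq>\<^bsub>L\<^esub> s \<and>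
      (\<forall>z\<in>carrier L. x \<sqsubseteq>\<^bsub>L\<^esub> z \<longrightarrow> y \<sqsubseteq>\<^bsub>L\<^esub> z \<longrightarrow> s \<sqsubseteq>\<^bsub>L\<^esub> z)"
    and meet: "\<And>x y. x \<in> carrier L \<Longrightarrow> y \<in> carrier L \<Longrightarrow> \<exists>s\<in>carrier L. s \<sqsubseteq>\<^bsub>L\<^esub> x \<and> s \<sqsubseteq>\<^bsub>L\<^esub> y \<and>
      (\<forall>z\<in>carrier L. z \<sqsubseteq>\<^bsub>L\<^esub> x \<longrightarrow> z \<sqsubseteq>\<^bsub>L\<^esub> y \<longrightarrow> z \<sqsubseteq>\<^bsub>L\<^esub> s)"
  shows "lattice L"
proof -
  interpret partial_order L
  proof unfold_locales
    show "x .=\<^bsub>L\<^esub> y" if "x \<sqsubseteq>\<^bsub>L\<^esub> y" "y \<sqsubseteq>\<^bsub>L\<^esub> x" "x \<in> carrier L" "y \<in> carrier L" for x y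
      using antisym[of x y] that by (simp add: eq)
    show "x \<sqsubseteq>\<^bsub>L\<^esub> z" if "x \<sqsubseteq>\<^bsub>L\<^esub> y" "y \<sqsubseteq>\<^bsub>L\<^esub> z" "x \<in> carrier L" "y \<in> carrier L" "z \<in> carrier L"
      for x y z
      using trans[of x y z] that by simp
  qed (simp_all add: eq refl)
  show ?thesis
  proof unfold_locales
    fix x y assume xy: "x \<in> carrier L" "y \<in> carrier L"
    obtain s where "s \<in> carrier L" "x \<sqsubseteq>\<^bsub>L\<^esub> s" "y \<sqsubseteq>\<^bsub>L\<^esub> s"
      "\<forall>z\<in>carrier L. x \<sqsubseteq>\<^bsub>L\<^esub> z \<longrightarrow> y \<sqsubseteq>\<^bsub>L\<^esub> z \<longrightarrow> s \<sqsubseteq>\<^bsub>L\<^esub> z"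
      using join[OF xy] by auto
    then have "least L s (Upper L {x, y})"
      using xy by (simp add: least_def Upper_def)
    then show "\<exists>s. least L s (Upper L {x, y})" ..
    obtain t where "t \<in> carrier L" "t \<sqsubseteq>\<^bsub>L\<^esub> x" "t \<sqsubseteq>\<^bsub>L\<^esub> y"
      "\<forall>z\<in>carrier L. z \<sqsubseteq>\<^bsub>L\<^esub> x \<longrightarrow> z \<sqsubseteq>\<^bsub>L\<^esub> y \<longrightarrow> z \<sqsubseteq>\<^bsub>L\<^esub> t"
      using meet[OF xy] by auto
    then have "greatest L t (Lower L {x, y})"
      using xy by (simp add: greatest_def Lower_def)
    then show "\<exists>s. greatest L s (Lower L {x, y})" ..
  qed
qed

text \<open>The lattice structure of \<open>K\<close> is itself obtained here, by pulling joins and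
  meets back along \<open>f\<close>.\<close>

lemma order_iso_lattice:
  assumes L: "lattice L" and eq: "eq K = (=)" and f: "bij_betw f (carrier K) (carrier L)"
    and le: "\<And>x y. x \<in> carrier K \<Longrightarrow> y \<in> carrier K \<Longrightarrow> x \<sqsubseteq>\<^bsub>K\<^esub> y \<longleftrightarrow> f x \<sqsubseteq>\<^bsub>L\<^esub> f y"
  shows "lattice K" "join_pres K L f" "meet_pres K L f"
proof -
  interpret L: lattice L by fact
  have fc: "f x \<in> carrier L" if "x \<in> carrier K" for x
    using f that bij_betwE by metis
  have surj: "\<exists>x\<in>carrier K. f x = y" if "y \<in> carrier L" for y
  proof -
    have "y \<in> f ` carrier K"
      using f that by (simp add: bij_betw_def)
    then show ?thesis by blast
  qed
  have inj: "x = y" if "x \<in> carrier K" "y \<in> carrier K" "f x = f y" for x y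
    using f that by (auto simp: bij_betw_def dest: inj_onD)
  have joins: "\<exists>s\<in>carrier K. f s = f x \<squnion>\<^bsub>L\<^esub> f y \<and> x \<sqsubseteq>\<^bsub>K\<^esub> s \<and> y \<sqsubseteq>\<^bsub>K\<^esub> s \<and>
      (\<forall>z\<in>carrier K. x \<sqsubseteq>\<^bsub>K\<^esub> z \<longrightarrow> y \<sqsubseteq>\<^bsub>K\<^esub> z \<longrightarrow> s \<sqsubseteq>\<^bsub>K\<^esub> z)"
    if xy: "x \<in> carrier K" "y \<in> carrier K" for x y
  proof -
    obtain s where s: "s \<in> carrier K" "f s = f x \<squnion>\<^bsub>L\<^esub> f y"
      using surj[OF L.join_closed[OF fc fc]] xy by blast
    show ?thesis
    proof (intro bexI[of _ s] conjI ballI impI)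
      show "x \<sqsubseteq>\<^bsub>K\<^esub> s" "y \<sqsubseteq>\<^bsub>K\<^esub> s"
        using le[OF xy(1) s(1)] le[OF xy(2) s(1)] s(2) L.join_left[of "f x" "f y"] L.join_right[of "f x" "f y"] fc xy
        by simp_all
      show "s \<sqsubseteq>\<^bsub>K\<^esub> z" if z: "z \<in> carrier K" "x \<sqsubseteq>\<^bsub>K\<^esub> z" "y \<sqsubseteq>\<^bsub>K\<^esub> z" for z
        using le[OF xy(1) z(1)] le[OF xy(2) z(1)] le[OF s(1) z(1)] s(2) L.join_le[of "f x" "f z" "f y"] fc xy z
        by simp
    qed (use s in auto)
  qed
  have meets: "\<exists>s\<in>carrier K. f s = f x \<sqinter>\<^bsub>L\<^esub> f y \<and> s \<sqsubseteq>\<^bsub>K\<^esub> x \<and> s \<sqsubseteq>\<^bsub>K\<^esub> y \<and>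
      (\<forall>z\<in>carrier K. z \<sqsubseteq>\<^bsub>K\<^esub> x \<longrightarrow> z \<sqsubseteq>\<^bsub>K\<^esub> y \<longrightarrow> z \<sqsubseteq>\<^bsub>K\<^esub> s)"
    if xy: "x \<in> carrier K" "y \<in> carrier K" for x y
  proof -
    obtain s where s: "s \<in> carrier K" "f s = f x \<sqinter>\<^bsub>L\<^esub> f y"
      using surj[OF L.meet_closed[OF fc fc]] xy by blast
    show ?thesis
    proof (intro bexI[of _ s] conjI ballI impI)
      show "s \<sqsubseteq>\<^bsub>K\<^esub> x" "s \<sqsubseteq>\<^bsub>K\<^esub> y"
        using le[OF s(1) xy(1)] le[OF s(1) xy(2)] s(2) L.meet_left[of "f x" "f y"] L.meet_right[of "f x" "f y"] fc xy
        by simp_all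
      show "z \<sqsubseteq>\<^bsub>K\<^esub> s" if z: "z \<in> carrier K" "z \<sqsubseteq>\<^bsub>K\<^esub> x" "z \<sqsubseteq>\<^bsub>K\<^esub> y" for z
        using le[OF z(1) xy(1)] le[OF z(1) xy(2)] le[OF z(1) s(1)] s(2) L.meet_le[of "f z" "f x" "f y"] fc xy z
        by simp
    qed (use s in auto)
  qed
  show K: "lattice K"
  proof (rule latticeI[OF eq])
    show "x \<sqsubseteq>\<^bsub>K\<^esub> x" if "x \<in> carrier K" for x
      using that le fc by simp
    show "x = y" if "x \<in> carrier K" "y \<in> carrier K" "x \<sqsubseteq>\<^bsub>K\<^esub> y" "y \<sqsubseteq>\<^bsub>K\<^esub> x" for x y
      using that le fc inj[of x y] L.le_antisym by simp
    show "x \<sqsubseteq>\<^bsub>K\<^esub> z" if "x \<in> carrier K" "y \<in> carrier K" "z \<in> carrier K" "x \<sqsubseteq>\<^bsub>K\<^esub> y" "y \<sqsubseteq>\<^bsub>K\<^esub> z"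
      for x y z
      using that le fc L.le_trans[of "f x" "f y" "f z"] by simp
  qed (use joins meets in blast)+
  show "join_pres K L f"
    unfolding join_pres_def
  proof (intro conjI ballI)
    fix x y assume xy: "x \<in> carrier K" "y \<in> carrier K"
    from joins[OF this] obtain s where "s \<in> carrier K" "f s = f x \<squnion>\<^bsub>L\<^esub> f y" "x \<squnion>\<^bsub>K\<^esub> y = s"
      using join_eqI[OF K xy] by blast
    then show "f (x \<squnion>\<^bsub>K\<^esub> y) = f x \<squnion>\<^bsub>L\<^esub> f y" by simp
  qed fact+
  show "meet_pres K L f"
    unfolding meet_pres_def
  proof (intro conjI ballI)
    fix x y assume xy: "x \<in> carrier K" "y \<in> carrier K"
    from meets[OF this] obtain s where "s \<in> carrier K" "f s = f x \<sqinter>\<^bsub>L\<^esub> f y" "x \<sqinter>\<^bsub>K\<^esub> y = s"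
      using meet_eqI[OF K xy] by blast
    then show "f (x \<sqinter>\<^bsub>K\<^esub> y) = f x \<sqinter>\<^bsub>L\<^esub> f y" by simp
  qed fact+
qed

lemma lattice_isomorphicI:
  assumes "lattice L" "eq K = (=)" "bij_betw f (carrier K) (carrier L)"
    "\<And>x y. x \<in> carrier K \<Longrightarrow> y \<in> carrier K \<Longrightarrow> x \<sqsubseteq>\<^bsub>K\<^esub> y \<longleftrightarrow> f x \<sqsubseteq>\<^bsub>L\<^esub> f y"
  shows "lattice_isomorphic K L"
  unfolding lattice_isomorphic_def using order_iso_lattice[OF assms] assms(3) by blast

lemma lattice_sublattice:
  assumes "sublattice S L"
  shows "lattice (L\<lparr>carrier := S\<rparr>)"
proof -
  interpret lattice L
    using assms by (simp add: sublattice_def)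
  have S: "S \<subseteq> carrier L" "\<And>x y. x \<in> S \<Longrightarrow> y \<in> S \<Longrightarrow> x \<squnion>\<^bsub>L\<^esub> y \<in> S \<and> x \<sqinter>\<^bsub>L\<^esub> y \<in> S"
    using assms by (auto simp: sublattice_def)
  show ?thesis
  proof (rule latticeI)
    fix x y assume xy: "x \<in> carrier (L\<lparr>carrier := S\<rparr>)" "y \<in> carrier (L\<lparr>carrier := S\<rparr>)"
    then have xy': "x \<in> carrier L" "y \<in> carrier L"
      using S(1) by auto
    let ?S = "L\<lparr>carrier := S\<rparr>"
    show "\<exists>s\<in>carrier ?S. x \<sqsubseteq>\<^bsub>?S\<^esub> s \<and> y \<sqsubseteq>\<^bsub>?S\<^esub> s \<and>
        (\<forall>z\<in>carrier ?S. x \<sqsubseteq>\<^bsub>?S\<^esub> z \<longrightarrow> y \<sqsubseteq>\<^bsub>?S\<^esub> z \<longrightarrow> s \<sqsubseteq>\<^bsub>?S\<^esub> z)"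
      using xy xy' S join_left join_right join_le by (intro bexI[of _ "x \<squnion>\<^bsub>L\<^esub> y"]) auto
    show "\<exists>s\<in>carrier ?S. s \<sqsubseteq>\<^bsub>?S\<^esub> x \<and> s \<sqsubseteq>\<^bsub>?S\<^esub> y \<and>
        (\<forall>z\<in>carrier ?S. z \<sqsubseteq>\<^bsub>?S\<^esub> x \<longrightarrow> z \<sqsubseteq>\<^bsub>?S\<^esub> y \<longrightarrow> z \<sqsubseteq>\<^bsub>?S\<^esub> s)"
      using xy xy' S meet_left meet_right meet_le by (intro bexI[of _ "x \<sqinter>\<^bsub>L\<^esub> y"]) auto
  next
    fix x y z assume xyz: "x \<in> carrier (L\<lparr>carrier := S\<rparr>)" "y \<in> carrier (L\<lparr>carrier := S\<rparr>)"
      "z \<in> carrier (L\<lparr>carrier := S\<rparr>)"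
      "x \<sqsubseteq>\<^bsub>L\<lparr>carrier := S\<rparr>\<^esub> y" "y \<sqsubseteq>\<^bsub>L\<lparr>carrier := S\<rparr>\<^esub> z"
    then show "x \<sqsubseteq>\<^bsub>L\<lparr>carrier := S\<rparr>\<^esub> z"
      using S(1) le_trans[of x y z] by auto
  qed (use S(1) in \<open>auto simp: eq_is_equal\<close>)
qed

section \<open>Closure operators with a left adjoint\<close>

context
  fixes L :: "'a gorder" and p :: "'a \<Rightarrow> 'a"
  assumes L: "lattice L"
    and p_closed: "\<And>x. x \<in> carrier L \<Longrightarrow> p x \<in> carrier L"
    and p_mono: "\<And>x y. x \<in> carrier L \<Longrightarrow> y \<in> carrier L \<Longrightarrow> x \<sqsubseteq>\<^bsub>L\<^esub> y \<Longrightarrow> p x \<sqsubseteq>\<^bsub>L\<^esub> p y"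
    and p_ext: "\<And>x. x \<in> carrier L \<Longrightarrow> x \<sqsubseteq>\<^bsub>L\<^esub> p x"
    and p_idem: "\<And>x. x \<in> carrier L \<Longrightarrow> p (p x) = p x"
    and p_join_fixed: "\<And>x y. x \<in> carrier L \<Longrightarrow> y \<in> carrier L \<Longrightarrow> p (p x \<squnion>\<^bsub>L\<^esub> p y) = p x \<squnion>\<^bsub>L\<^esub> p y"
    and p_adjoint: "\<And>z. z \<in> carrier L \<Longrightarrow>
      \<exists>d\<in>carrier L. z \<sqsubseteq>\<^bsub>L\<^esub> p d \<and> (\<forall>x\<in>carrier L. z \<sqsubseteq>\<^bsub>L\<^esub> p x \<longrightarrow> d \<sqsubseteq>\<^bsub>L\<^esub> x)"
begin

interpretation lattice L by (rule L)

abbreviation kernel :: "('a \<times> 'a) set" where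
  "kernel \<equiv> {(x, y). x \<in> carrier L \<and> y \<in> carrier L \<and> p x = p y}"

text \<open>The join of \<open>p x\<close> and \<open>p y\<close> is a fixed point above the join of
  \<open>x\<close> and \<open>y\<close>, hence above the image of that join.\<close>

lemma p_join:
  assumes xy: "x \<in> carrier L" "y \<in> carrier L"
  shows "p (x \<squnion>\<^bsub>L\<^esub> y) = p x \<squnion>\<^bsub>L\<^esub> p y"
proof (rule le_antisym)
  note c = xy p_closed[OF xy(1)] p_closed[OF xy(2)]
  have "x \<sqsubseteq>\<^bsub>L\<^esub> p x \<squnion>\<^bsub>L\<^esub> p y" "y \<sqsubseteq>\<^bsub>L\<^esub> p x \<squnion>\<^bsub>L\<^esub> p y"
    using c p_ext join_left[of "p x" "p y"] join_right[of "p x" "p y"] by (meson le_trans join_closed)+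
  then have "x \<squnion>\<^bsub>L\<^esub> y \<sqsubseteq>\<^bsub>L\<^esub> p x \<squnion>\<^bsub>L\<^esub> p y"
    using c by (simp add: join_le)
  then have "p (x \<squnion>\<^bsub>L\<^esub> y) \<sqsubseteq>\<^bsub>L\<^esub> p (p x \<squnion>\<^bsub>L\<^esub> p y)"
    using c by (simp add: p_mono)
  then show "p (x \<squnion>\<^bsub>L\<^esub> y) \<sqsubseteq>\<^bsub>L\<^esub> p x \<squnion>\<^bsub>L\<^esub> p y"
    using p_join_fixed[OF xy] by simp
  show "p x \<squnion>\<^bsub>L\<^esub> p y \<sqsubseteq>\<^bsub>L\<^esub> p (x \<squnion>\<^bsub>L\<^esub> y)"
    using c by (simp add: join_le p_mono p_closed join_left join_right)
qed (use xy p_closed in auto)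

text \<open>The left adjoint at the meet of \<open>p x\<close> and \<open>p y\<close> is below both
  \<open>x\<close> and \<open>y\<close>, hence below their meet; applying \<open>p\<close> gives the
  nontrivial inequality.\<close>

lemma p_meet:
  assumes xy: "x \<in> carrier L" "y \<in> carrier L"
  shows "p (x \<sqinter>\<^bsub>L\<^esub> y) = p x \<sqinter>\<^bsub>L\<^esub> p y"
proof (rule le_antisym)
  note c = xy p_closed[OF xy(1)] p_closed[OF xy(2)]
  show "p (x \<sqinter>\<^bsub>L\<^esub> y) \<sqsubseteq>\<^bsub>L\<^esub> p x \<sqinter>\<^bsub>L\<^esub> p y"
    using c by (simp add: meet_le p_mono p_closed meet_left meet_right)
  obtain d where d: "d \<in> carrier L" "p x \<sqinter>\<^bsub>L\<^esub> p y \<sqsubseteq>\<^bsub>L\<^esub> p d"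
    "\<And>z. z \<in> carrier L \<Longrightarrow> p x \<sqinter>\<^bsub>L\<^esub> p y \<sqsubseteq>\<^bsub>L\<^esub> p z \<Longrightarrow> d \<sqsubseteq>\<^bsub>L\<^esub> z"
    using p_adjoint[of "p x \<sqinter>\<^bsub>L\<^esub> p y"] c by auto
  have "d \<sqsubseteq>\<^bsub>L\<^esub> x \<sqinter>\<^bsub>L\<^esub> y"
    using c d by (simp add: meet_le meet_left meet_right)
  then have "p d \<sqsubseteq>\<^bsub>L\<^esub> p (x \<sqinter>\<^bsub>L\<^esub> y)"
    using c d by (simp add: p_mono)
  then show "p x \<sqinter>\<^bsub>L\<^esub> p y \<sqsubseteq>\<^bsub>L\<^esub> p (x \<sqinter>\<^bsub>L\<^esub> y)"
    using c d by (meson le_trans meet_closed p_closed)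
qed (use xy p_closed in auto)

lemma sublattice_image: "sublattice (p ` carrier L) L"
  unfolding sublattice_def
proof (intro conjI ballI)
  fix x y assume "x \<in> p ` carrier L" "y \<in> p ` carrier L"
  then obtain x' y' where *: "x' \<in> carrier L" "x = p x'" "y' \<in> carrier L" "y = p y'"
    by auto
  show "x \<squnion>\<^bsub>L\<^esub> y \<in> p ` carrier L" "x \<sqinter>\<^bsub>L\<^esub> y \<in> p ` carrier L"
    using * by (simp_all flip: p_join p_meet)
qed (use L p_closed in auto)

lemma lattice_congruence_kernel: "lattice_congruence kernel L"
  unfolding lattice_congruence_def
proof (intro conjI)
  show "equiv (carrier L) kernel"
    by (rule equivI) (auto simp: refl_on_def sym_def trans_def)
qed (use L in \<open>auto simp: p_join p_meet\<close>)

text \<open>Each class contains exactly one fixed point, the image of any member. Classes are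
  compared through joins, and the join of two fixed points is again fixed, so the comparison reduces
  to the fixed points.\<close>

lemma quotient_kernel_iso:
  "bij_betw (\<lambda>s. kernel `` {s}) (p ` carrier L) (carrier L // kernel)"
  "\<And>s t. s \<in> p ` carrier L \<Longrightarrow> t \<in> p ` carrier L \<Longrightarrow>
     kernel `` {s} \<sqsubseteq>\<^bsub>quotient_lattice L kernel\<^esub> kernel `` {t} \<longleftrightarrow> s \<sqsubseteq>\<^bsub>L\<^esub> t"
proof -
  have S: "s \<in> carrier L" "p s = s" if "s \<in> p ` carrier L" for s
    using that p_closed p_idem by auto
  have class_eq: "kernel `` {x} = kernel `` {y} \<longleftrightarrow> p x = p y" if "x \<in> carrier L" "y \<in> carrier L" for x y
    using that by auto
  show "bij_betw (\<lambda>s. kernel `` {s}) (p ` carrier L) (carrier L // kernel)"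
    unfolding bij_betw_def
  proof
    show "inj_on (\<lambda>s. kernel `` {s}) (p ` carrier L)"
      using class_eq S by (metis (no_types, lifting) inj_onI)
    have eq: "kernel `` {x} = kernel `` {p x}" if "x \<in> carrier L" for x
      by (subst class_eq) (simp_all only: that p_closed p_idem)
    show "(\<lambda>s. kernel `` {s}) ` (p ` carrier L) = carrier L // kernel"
    proof (intro equalityI subsetI)
      fix X assume "X \<in> (\<lambda>s. kernel `` {s}) ` (p ` carrier L)"
      then obtain x where x: "x \<in> carrier L" "X = kernel `` {p x}" by blast
      show "X \<in> carrier L // kernel"
        unfolding x(2) by (rule quotientI[OF p_closed[OF x(1)]])
    next
      fix X assume "X \<in> carrier L // kernel"
      then obtain x where x: "x \<in> carrier L" "X = kernel `` {x}"
        by (rule quotientE)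
      show "X \<in> (\<lambda>s. kernel `` {s}) ` (p ` carrier L)"
        unfolding x(2) eq[OF x(1)] using x(1) by (intro imageI)
    qed
  qed
  fix s t assume st: "s \<in> p ` carrier L" "t \<in> p ` carrier L"
  note c = S[OF st(1)] S[OF st(2)]
  have "kernel `` {x \<squnion>\<^bsub>L\<^esub> y} = kernel `` {s \<squnion>\<^bsub>L\<^esub> t}" if "x \<in> kernel `` {s}" "y \<in> kernel `` {t}" for x y
    using that c by (subst class_eq) (auto simp: p_join)
  moreover have "s \<in> kernel `` {s}" "t \<in> kernel `` {t}"
    using c by auto
  ultimately have "quotient_join L kernel (kernel `` {s}) (kernel `` {t}) = kernel `` {s \<squnion>\<^bsub>L\<^esub> t}"
    unfolding quotient_join_def by blast
  then have "kernel `` {s} \<sqsubseteq>\<^bsub>quotient_lattice L kernel\<^esub> kernel `` {t} \<longleftrightarrow> kernel `` {s \<squnion>\<^bsub>L\<^esub> t} = kernel `` {t}"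
    by (simp add: quotient_lattice_def)
  also have "\<dots> \<longleftrightarrow> s \<squnion>\<^bsub>L\<^esub> t = t"
    using c by (subst class_eq) (simp_all add: p_join)
  also have "\<dots> \<longleftrightarrow> s \<sqsubseteq>\<^bsub>L\<^esub> t"
    using le_iff_meet[of s t] c by simp
  finally show "kernel `` {s} \<sqsubseteq>\<^bsub>quotient_lattice L kernel\<^esub> kernel `` {t} \<longleftrightarrow> s \<sqsubseteq>\<^bsub>L\<^esub> t" .
qed

lemma isomorphic_image_quotient:
  assumes eq: "eq K = (=)" and h: "bij_betw h (carrier K) (p ` carrier L)"
    and le: "\<And>x y. x \<in> carrier K \<Longrightarrow> y \<in> carrier K \<Longrightarrow> x \<sqsubseteq>\<^bsub>K\<^esub> y \<longleftrightarrow> h x \<sqsubseteq>\<^bsub>L\<^esub> h y"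
  shows "lattice_isomorphic K (L\<lparr>carrier := p ` carrier L\<rparr>)"
    and "lattice_isomorphic K (quotient_lattice L kernel)"
proof -
  let ?S = "L\<lparr>carrier := p ` carrier L\<rparr>" and ?Q = "quotient_lattice L kernel"
  let ?k = "\<lambda>s. kernel `` {s}"
  note S = lattice_sublattice[OF sublattice_image]
  show "lattice_isomorphic K ?S"
    using eq h le by (intro lattice_isomorphicI[OF S, of K h]) auto
  have Q: "carrier ?Q = carrier L // kernel" "eq ?Q = (=)"
    by (simp_all add: quotient_lattice_def)
  \<comment> \<open>The structure is transported from the image of \<open>p\<close>, which is a
    lattice as a sublattice.\<close>
  have "lattice ?Q"
  proof (rule order_iso_lattice(1)[OF S])
    show "bij_betw (inv_into (p ` carrier L) ?k) (carrier ?Q) (carrier ?S)"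
      using bij_betw_inv_into[OF quotient_kernel_iso(1)] by (simp add: Q)
    fix X Y assume "X \<in> carrier ?Q" "Y \<in> carrier ?Q"
    then obtain s t where *: "s \<in> p ` carrier L" "X = ?k s" "t \<in> p ` carrier L" "Y = ?k t"
      using quotient_kernel_iso(1) unfolding Q bij_betw_def by (metis (no_types, lifting) imageE)
    then show "X \<sqsubseteq>\<^bsub>?Q\<^esub> Y \<longleftrightarrow> inv_into (p ` carrier L) ?k X \<sqsubseteq>\<^bsub>?S\<^esub> inv_into (p ` carrier L) ?k Y"
      using quotient_kernel_iso(2)[of s t] bij_betw_inv_into_left[OF quotient_kernel_iso(1)] by simp
  qed (rule Q)
  then show "lattice_isomorphic K ?Q"
  proof (rule lattice_isomorphicI[OF _ eq])
    show "bij_betw (?k \<circ> h) (carrier K) (carrier ?Q)"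
      using bij_betw_trans[OF h quotient_kernel_iso(1)] by (simp add: Q)
    show "x \<sqsubseteq>\<^bsub>K\<^esub> y \<longleftrightarrow> (?k \<circ> h) x \<sqsubseteq>\<^bsub>?Q\<^esub> (?k \<circ> h) y" if "x \<in> carrier K" "y \<in> carrier K" for x y
      using le[OF that] quotient_kernel_iso(2)[of "h x" "h y"] that bij_betwE[OF h] by simp
  qed
qed

end

section \<open>The sublattice and the quotient\<close>

theorem theorem4p7:
  fixes m n :: nat
  assumes "m \<ge> 1" and "n \<ge> 1"
  shows "(\<exists>S. sublattice S (metasylvester m n) \<and>
            lattice_isomorphic (inv_gorder (tamari m n)) ((metasylvester m n)\<lparr>carrier := S\<rparr>)) \<and>
         (\<exists>\<theta>. lattice_congruence \<theta> (metasylvester m n) \<and>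
            lattice_isomorphic (inv_gorder (tamari m n)) (quotient_lattice (metasylvester m n) \<theta>))"
proof -
  let ?L = "metasylvester m n" and ?T = "table_lattice m n" and ?K = "inv_gorder (tamari m n)"
  let ?f = "table_of m"
  note m = assms(1)
  have car [simp]: "carrier ?L = metasylv_max m n" "carrier ?T = tables m n"
      "carrier (tamari m n) = {w. ballot_path m n w}"
    by (simp_all add: metasylvester_def table_lattice_def tamari_def)
  have bij: "bij_betw ?f (carrier ?L) (carrier ?T)"
    using table_of_iso(1)[OF m] by simp
  have le_f: "x \<sqsubseteq>\<^bsub>?L\<^esub> y \<longleftrightarrow> ?f x \<subseteq> ?f y" if "x \<in> carrier ?L" "y \<in> carrier ?L" for x y
    using table_of_iso(2)[OF m, of x n y] that by (simp add: metasylvester_def)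
  have f_tables: "?f x \<in> tables m n" if "x \<in> carrier ?L" for x
    using bij_betwE[OF bij] that by simp
  define g where "g = inv_into (carrier ?L) ?f"
  have fg: "?f (g X) = X" and g_closed: "g X \<in> carrier ?L" if "X \<in> tables m n" for X
    using bij_betw_inv_into_right[OF bij, of X] bij_betwE[OF bij_betw_inv_into[OF bij]] that
    unfolding g_def by auto
  have gf: "g (?f x) = x" if "x \<in> carrier ?L" for x
    using bij_betw_inv_into_left[OF bij that] unfolding g_def .
  have iso: "lattice ?L" "join_pres ?L ?T ?f"
    using order_iso_lattice[OF lattice_table_lattice _ bij] le_f
    by (simp_all add: metasylvester_def table_lattice_def)
  \<comment> \<open>The hull on tables, carried to words along the isomorphism
    \<open>table_of\<close>.\<close>
  define p where "p x = g (dec_hull (?f x))" for x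
  have hull: "dec_hull (?f x) \<in> dec_tables m n" "dec_hull (?f x) \<in> tables m n" if "x \<in> carrier ?L" for x
    using dec_hull_in_dec_tables[OF f_tables[OF that]] dec_tablesD by auto
  have fp: "?f (p x) = dec_hull (?f x)" and p_closed: "p x \<in> carrier ?L" if "x \<in> carrier ?L" for x
    using fg[OF hull(2)[OF that]] g_closed[OF hull(2)[OF that]] unfolding p_def by auto
  have p_dec: "p x = x" if "x \<in> carrier ?L" "?f x \<in> dec_tables m n" for x
    using gf[OF that(1)] dec_hull_dec[OF that(2)] unfolding p_def by simp
  have p_mono: "p x \<sqsubseteq>\<^bsub>?L\<^esub> p y" if "x \<in> carrier ?L" "y \<in> carrier ?L" "x \<sqsubseteq>\<^bsub>?L\<^esub> y" for x y
    using that le_f fp p_closed dec_hull_mono by simp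
  have p_ext: "x \<sqsubseteq>\<^bsub>?L\<^esub> p x" if "x \<in> carrier ?L" for x
    using le_f[OF that p_closed[OF that]] fp[OF that] dec_hull_extensive[OF f_tables[OF that]] by simp
  have p_idem: "p (p x) = p x" if "x \<in> carrier ?L" for x
    using p_dec[OF p_closed[OF that]] fp[OF that] hull(1)[OF that] by simp
  \<comment> \<open>Joins of tables are transitive closures of unions, which preserve decreasing
    tables.\<close>
  have p_join_fixed: "p (p x \<squnion>\<^bsub>?L\<^esub> p y) = p x \<squnion>\<^bsub>?L\<^esub> p y" if "x \<in> carrier ?L" "y \<in> carrier ?L" for x y
  proof (rule p_dec)
    interpret lattice ?L by (rule iso(1))
    show "p x \<squnion>\<^bsub>?L\<^esub> p y \<in> carrier ?L"
      by (rule join_closed[OF p_closed[OF that(1)] p_closed[OF that(2)]])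
    let ?X = "?f (p x)" and ?Y = "?f (p y)"
    have XY: "?X \<in> dec_tables m n" "?Y \<in> dec_tables m n"
      using fp hull(1) that by simp_all
    note cl = tclosure_Un_in_dec_tables[OF XY]
    have "?f (p x \<squnion>\<^bsub>?L\<^esub> p y) = ?X \<squnion>\<^bsub>?T\<^esub> ?Y"
      using iso(2) p_closed that unfolding join_pres_def by blast
    also have "\<dots> = tclosure (?X \<union> ?Y)"
    proof (rule join_eqI[OF lattice_table_lattice])
      show "tclosure (?X \<union> ?Y) \<sqsubseteq>\<^bsub>?T\<^esub> Z" if "Z \<in> carrier ?T" "?X \<sqsubseteq>\<^bsub>?T\<^esub> Z" "?Y \<sqsubseteq>\<^bsub>?T\<^esub> Z" for Z
        using that tclosure_least[of Z m n "?X \<union> ?Y"] by (simp add: table_lattice_def)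
    qed (use XY cl dec_tablesD tclosure.base in \<open>auto simp: table_lattice_def\<close>)
    finally show "?f (p x \<squnion>\<^bsub>?L\<^esub> p y) \<in> dec_tables m n"
      using cl by simp
  qed
  have p_adjoint: "\<exists>d\<in>carrier ?L. z \<sqsubseteq>\<^bsub>?L\<^esub> p d \<and> (\<forall>x\<in>carrier ?L. z \<sqsubseteq>\<^bsub>?L\<^esub> p x \<longrightarrow> d \<sqsubseteq>\<^bsub>?L\<^esub> x)"
    if z: "z \<in> carrier ?L" for z
  proof -
    let ?D = "tclosure (last_entries (?f z))"
    note D = tclosure_last_entries_in_tables[OF f_tables[OF z]]
    note d = g_closed[OF D] fg[OF D]
    have "z \<sqsubseteq>\<^bsub>?L\<^esub> p (g ?D)"
      using le_f[OF z p_closed[OF d(1)]] fp[OF d(1)] d(2)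
        subset_dec_hull_tclosure_last_entries[OF f_tables[OF z]] by simp
    moreover have "g ?D \<sqsubseteq>\<^bsub>?L\<^esub> x" if x: "x \<in> carrier ?L" "z \<sqsubseteq>\<^bsub>?L\<^esub> p x" for x
      using tclosure_last_entries_adjoint[OF f_tables[OF z] f_tables[OF x(1)]] x(2)
        le_f[OF z p_closed[OF x(1)]] fp[OF x(1)] le_f[OF d(1) x(1)] d(2) by simp
    ultimately show ?thesis using d(1) by blast
  qed
  note retract = iso(1) p_closed p_mono p_ext p_idem p_join_fixed p_adjoint
  \<comment> \<open>The fixed points are the words of decreasing tables, which ballot paths
    parametrise.\<close>
  have image: "p ` carrier ?L = g ` dec_tables m n"
  proof (intro equalityI subsetI)
    fix x assume "x \<in> g ` dec_tables m n"
    then obtain X where X: "X \<in> dec_tables m n" "x = g X" by blast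
    then have "x \<in> carrier ?L" "p x = x"
      using g_closed[OF dec_tablesD] fg[OF dec_tablesD] p_dec[of x] by simp_all
    then show "x \<in> p ` carrier ?L" by (metis imageI)
  qed (use hull(1) p_def in auto)
  have "inj_on g (dec_tables m n)"
    by (rule inj_on_inverseI[of _ ?f]) (use fg dec_tablesD in blast)
  then have "bij_betw g (dec_tables m n) (p ` carrier ?L)"
    unfolding image by (rule inj_on_imp_bij_betw)
  then have h: "bij_betw (g \<circ> table_of_path m n) (carrier ?K) (p ` carrier ?L)"
    using bij_betw_trans[OF bij_betw_table_of_path] by simp
  have le: "x \<sqsubseteq>\<^bsub>?K\<^esub> y \<longleftrightarrow> (g \<circ> table_of_path m n) x \<sqsubseteq>\<^bsub>?L\<^esub> (g \<circ> table_of_path m n) y"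
    if xy: "x \<in> carrier ?K" "y \<in> carrier ?K" for x y
  proof -
    have t: "table_of_path m n w \<in> tables m n" for w
      by (rule dec_tablesD[OF table_of_path_in_dec_tables])
    \<comment> \<open>Reversing the Tamari order cancels the reversal of inclusion in
      \<open>rotations_iff\<close>.\<close>
    have "x \<sqsubseteq>\<^bsub>?K\<^esub> y \<longleftrightarrow> (rotation m)\<^sup>*\<^sup>* y x"
      by (simp add: tamari_def)
    then show ?thesis
      using rotations_iff[OF m, of n y x] le_f[OF g_closed[OF t] g_closed[OF t], of x y] fg[OF t] xy by simp
  qed
  have eq: "eq ?K = (=)"
    by (simp add: tamari_def)
  show ?thesis
    using sublattice_image[OF retract] lattice_congruence_kernel[OF retract]
      isomorphic_image_quotient[OF retract eq h le] by blast
qed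

end
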